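(* Let $t$ be a prime power with $t\neq 2,3$, $q=t^2$, and let $\mathcal{X}\subset\mathbb{P}^4(\mathbb{F}_q)$ be the non-degenerate hermitian variety $x_0^{t+1}+x_1^{t+1}+x_2^{t+1}+x_3^{t+1}+x_4^{t+1}=0$. The fifth weight of the code $C_2(\mathcal{X})$ is $t^7-t^5+t^3-t^2$. The codewords of fifth weight are exactly the codewords $c(f)$ for which the quadric $Z(f)$ is a pair of distinct hyperplanes (over $\mathbb{F}_q$), both tangent to $\mathcal{X}$, such that the plane of intersection of the two hyperplanes intersects $\mathcal{X}$ in a non-singular hermitian plane curve.
   Context: Functional code: let $\mathcal{F}_2$ be the $\mathbb{F}_q$-vector space of forms of degree 2 in $x_0,\dots,x_4$ (with $0$). The code $C_2(\mathcal{X})$ is the image of the linear map $c:\mathcal{F}_2\to\mathbb{F}_q^{|\mathcal{X}|}$, $c(f)=(c_x(f))_{x\in\mathcal{X}(\mathbb{F}_q)}$, where $c_x(f)=f(x_0,\dots,x_4)/x_i^2$ for $x=(x_0:\dots:x_4)$ and $i$ the smallest index with $x_i\ne0$. The weight of $c(f)$ is $\#\mathcal{X}(\mathbb{F}_q)-\#(\mathcal{X}\cap Z(f))(\mathbb{F}_q)$, where $Z(f)$ is the zero set of $f$ in $\mathbb{P}^4(\mathbb{F}_q)$. The $i$-th weight of the code is the $i$-th smallest value among the weights of nonzero codewords. A hyperplane is tangent to $\mathcal{X}$ if it is the tangent hyperplane $\sum_i p_i^t x_i=0$ at some point $P=(p_0:\dots:p_4)$ of $\mathcal{X}$. The intersection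 of $\mathcal{X}$ with a plane is a hermitian plane curve; it is non-singular if the restricted hermitian form has rank 3. *)

theory Defs
  imports "HOL-Analysis.Analysis" "HOL-Library.Poly_Mapping" "HOL-Number_Theory.Prime_Powers"
begin

section \<open>Projective space over a field\<close>

text \<open>
  A projective point is the class of its nonzero coordinate vectors, and
  \<^typ>\<open>'a ^ 5\<close> over a field with \<open>q\<close> elements gives \<open>\<PP>\<^sup>4(\<FF>\<^sub>q)\<close>.  The elements of the
  index type \<^typ>\<open>5\<close> are \<open>0 < 1 < 2 < 3 < 4\<close>.
\<close>

definition proj_rel :: "(('a::field ^ 'n) \<times> ('a ^ 'n)) set" where
  "proj_rel = {(x, y). x \<noteq> 0 \<and> (\<exists>c. c \<noteq> 0 \<and> y = c *s x)}"

definition proj_space :: "('a::field ^ 'n) set set" where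
  "proj_space = (UNIV - {0}) // proj_rel"

definition cone :: "('a::field ^ 'n) set set \<Rightarrow> ('a ^ 'n) set" where
  "cone S = insert 0 (\<Union>S)"

definition hyperplane :: "'a::field ^ 'n \<Rightarrow> ('a ^ 'n) set set" where
  "hyperplane a = {P \<in> proj_space. \<forall>x\<in>P. (\<Sum>i\<in>UNIV. a $ i * x $ i) = 0}"

definition is_hyperplane :: "('a::field ^ 'n) set set \<Rightarrow> bool" where
  "is_hyperplane H \<longleftrightarrow> (\<exists>a. a \<noteq> 0 \<and> H = hyperplane a)"


section \<open>Forms\<close>

text \<open>
  A polynomial maps exponent vectors (finitely supported functions on the index type) to
  coefficients.
\<close>

type_synonym ('n, 'a) mpol = "('n \<Rightarrow>\<^sub>0 nat) \<Rightarrow>\<^sub>0 'a"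

definition eval_form :: "('n::finite, 'a::field) mpol \<Rightarrow> 'a ^ 'n \<Rightarrow> 'a" where
  "eval_form f x =
     (\<Sum>m\<in>Poly_Mapping.keys f. Poly_Mapping.lookup f m * (\<Prod>i\<in>UNIV. x $ i ^ Poly_Mapping.lookup m i))"

definition quadratic_forms :: "('n::finite, 'a::field) mpol set" where
  "quadratic_forms =
     {f. \<forall>m\<in>Poly_Mapping.keys f. (\<Sum>i\<in>UNIV. Poly_Mapping.lookup m i) = 2}"

definition zero_set :: "('n::finite, 'a::field) mpol \<Rightarrow> ('a ^ 'n) set set" where
  "zero_set f = {P \<in> proj_space. \<forall>x\<in>P. eval_form f x = 0}"


section \<open>The hermitian variety\<close>

definition hermitian_form :: "nat \<Rightarrow> 'a::field ^ 'n \<Rightarrow> 'a ^ 'n \<Rightarrow> 'a" where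
  "hermitian_form t x y = (\<Sum>i\<in>UNIV. x $ i * (y $ i) ^ t)"

definition hermitian_variety :: "nat \<Rightarrow> ('a::field ^ 'n) set set" where
  "hermitian_variety t = {P \<in> proj_space. \<forall>x\<in>P. (\<Sum>i\<in>UNIV. x $ i ^ (t + 1)) = 0}"

definition tangent_to_hermitian :: "nat \<Rightarrow> ('a::field ^ 'n) set set \<Rightarrow> bool" where
  "tangent_to_hermitian t H \<longleftrightarrow>
     (\<exists>P\<in>hermitian_variety t. \<exists>p\<in>P. H = hyperplane (\<chi> i. p $ i ^ t))"

definition hermitian_gram :: "nat \<Rightarrow> 'a::field ^ 'n ^ 'm \<Rightarrow> 'a ^ 'm ^ 'm" where
  "hermitian_gram t B = (\<chi> i j. hermitian_form t (B $ i) (B $ j))"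

text \<open>
  The rows of \<open>B\<close> are a basis of the vector space underlying the projective plane \<open>E\<close>, so that
  \<^term>\<open>hermitian_gram t B\<close> is the matrix of the restriction of the hermitian form to \<open>E\<close>.
\<close>

definition nonsingular_plane_section :: "nat \<Rightarrow> ('a::field ^ 'n) set set \<Rightarrow> bool" where
  "nonsingular_plane_section t E \<longleftrightarrow>
     (\<exists>B :: 'a ^ 'n ^ 3. inj (($) B) \<and> vec.independent (rows B) \<and> vec.span (rows B) = cone E \<and>
        rank (hermitian_gram t B) = 3)"


section \<open>Functional codes\<close>

definition first_nonzero :: "'a::zero ^ 'n::{finite,wellorder} \<Rightarrow> 'n" where
  "first_nonzero x = (LEAST i. x $ i \<noteq> 0)"

text \<open>The value does not depend on the chosen representative, see \<open>code_coord_eq\<close> below.\<close>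

definition code_coord ::
  "('n::{finite,wellorder}, 'a::field) mpol \<Rightarrow> ('a, 'n) vec set \<Rightarrow> 'a" where
  "code_coord f P = (let x = (SOME x. x \<in> P) in eval_form f x / (x $ first_nonzero x)\<^sup>2)"

text \<open>
  Words indexed by the points of \<open>X\<close> are represented as functions that are 0 outside \<open>X\<close>.
\<close>

definition codeword ::
  "('a::field, 'n::{finite,wellorder}) vec set set \<Rightarrow> ('n, 'a) mpol \<Rightarrow> ('a, 'n) vec set \<Rightarrow> 'a" where
  "codeword X f = (\<lambda>P. if P \<in> X then code_coord f P else 0)"

definition functional_code2 ::
  "('a::field, 'n::{finite,wellorder}) vec set set \<Rightarrow> (('a, 'n) vec set \<Rightarrow> 'a) set" where
  "functional_code2 X = codeword X ` quadratic_forms"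

definition hamming_weight :: "'p set \<Rightarrow> ('p \<Rightarrow> 'a::zero) \<Rightarrow> nat" where
  "hamming_weight X w = card {P \<in> X. w P \<noteq> 0}"

definition nonzero_weights :: "'p set \<Rightarrow> ('p \<Rightarrow> 'a::zero) set \<Rightarrow> nat set" where
  "nonzero_weights X C = hamming_weight X ` (C - {\<lambda>_. 0})"

text \<open>
  \<open>w\<close> is the \<open>i\<close>-th smallest weight; distinct codewords of equal weight count once.
\<close>

definition is_ith_weight :: "nat \<Rightarrow> 'p set \<Rightarrow> ('p \<Rightarrow> 'a::zero) set \<Rightarrow> nat \<Rightarrow> bool" where
  "is_ith_weight i X C w \<longleftrightarrow>
     w \<in> nonzero_weights X C \<and> card {v \<in> nonzero_weights X C. v \<le> w} = i"


section \<open>Well-definedness\<close>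

lemma equiv_proj_rel: "equiv (UNIV - {0}) (proj_rel :: (('a::field ^ 'n) \<times> ('a ^ 'n)) set)"
proof (rule equivI)
  show "proj_rel \<subseteq> (UNIV - {0}) \<times> (UNIV - {0 :: 'a ^ 'n})"
    by (auto simp: proj_rel_def)
  show "refl_on (UNIV - {0}) (proj_rel :: (('a ^ 'n) \<times> ('a ^ 'n)) set)"
  proof (rule refl_onI)
    fix x :: "'a ^ 'n"
    assume "x \<in> UNIV - {0}"
    then have "x \<noteq> 0 \<and> (1::'a) \<noteq> 0 \<and> x = 1 *s x" by simp
    then show "(x, x) \<in> proj_rel"
      unfolding proj_rel_def mem_Collect_eq prod.case by (intro conjI exI[of _ 1]) auto
  qed
  show "sym (proj_rel :: (('a ^ 'n) \<times> ('a ^ 'n)) set)"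
  proof (rule symI)
    fix x y :: "'a ^ 'n"
    assume "(x, y) \<in> proj_rel"
    then obtain c where c: "x \<noteq> 0" "c \<noteq> 0" "y = c *s x" by (auto simp: proj_rel_def)
    then have "y \<noteq> 0" "x = inverse c *s y" by (auto simp: vector_smult_assoc)
    moreover have "inverse c \<noteq> 0" using c by simp
    ultimately have "y \<noteq> 0 \<and> (\<exists>d. d \<noteq> 0 \<and> x = d *s y)" by (intro conjI exI)
    then show "(y, x) \<in> proj_rel" unfolding proj_rel_def mem_Collect_eq prod.case .
  qed
  show "trans (proj_rel :: (('a ^ 'n) \<times> ('a ^ 'n)) set)"
  proof (rule transI)
    fix x y z :: "'a ^ 'n"
    assume "(x, y) \<in> proj_rel" "(y, z) \<in> proj_rel"
    then obtain c d where cd: "x \<noteq> 0" "c \<noteq> 0" "y = c *s x" "d \<noteq> 0" "z = d *s y"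
      by (auto simp: proj_rel_def)
    then have "d * c \<noteq> 0" "z = (d * c) *s x" by (simp_all add: vector_smult_assoc)
    with cd(1) have "x \<noteq> 0 \<and> (\<exists>e. e \<noteq> 0 \<and> z = e *s x)" by (intro conjI exI)
    then show "(x, z) \<in> proj_rel" unfolding proj_rel_def mem_Collect_eq prod.case .
  qed
qed

lemma proj_space_rep:
  assumes "P \<in> proj_space" "x \<in> P"
  shows "x \<noteq> 0" "P = {c *s x | c. c \<noteq> 0}"
proof -
  from assms obtain y where y: "y \<noteq> 0" "P = proj_rel `` {y}"
    by (auto simp: proj_space_def quotient_def)
  with assms(2) have yx: "(y, x) \<in> proj_rel" by auto
  then show nz: "x \<noteq> 0" by (auto simp: proj_rel_def)
  from equiv_class_eq[OF equiv_proj_rel yx] y have "P = proj_rel `` {x}" by simp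
  with nz show "P = {c *s x | c. c \<noteq> 0}" by (auto simp: proj_rel_def)
qed

lemma some_in_proj: "P \<in> proj_space \<Longrightarrow> (SOME x. x \<in> P) \<in> P"
  using in_quotient_imp_non_empty[OF equiv_proj_rel, of P]
  by (auto simp: proj_space_def some_in_eq)

lemma first_nonzero_neq: "x \<noteq> 0 \<Longrightarrow> x $ first_nonzero x \<noteq> 0"
  unfolding first_nonzero_def by (rule LeastI_ex) (auto simp: vec_eq_iff)

lemma first_nonzero_scale: "c \<noteq> (0::'a::field) \<Longrightarrow> first_nonzero (c *s x) = first_nonzero x"
  by (simp add: first_nonzero_def)

lemma eval_form_scale:
  assumes "f \<in> quadratic_forms"
  shows "eval_form f (c *s x) = c\<^sup>2 * eval_form f x"
proof -
  have "Poly_Mapping.lookup f m * (\<Prod>i\<in>UNIV. (c *s x) $ i ^ Poly_Mapping.lookup m i) =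
      c\<^sup>2 * (Poly_Mapping.lookup f m * (\<Prod>i\<in>UNIV. x $ i ^ Poly_Mapping.lookup m i))"
    if "m \<in> Poly_Mapping.keys f" for m
  proof -
    have "(\<Prod>i\<in>UNIV. c ^ Poly_Mapping.lookup m i) = c\<^sup>2"
      using assms that by (simp add: quadratic_forms_def flip: power_sum)
    then show ?thesis by (simp add: power_mult_distrib prod.distrib)
  qed
  then show ?thesis unfolding eval_form_def sum_distrib_left by (intro sum.cong refl)
qed

lemma code_coord_eq:
  assumes "f \<in> quadratic_forms" "P \<in> proj_space" "x \<in> P"
  shows "code_coord f P = eval_form f x / (x $ first_nonzero x)\<^sup>2"
proof -
  obtain c where c: "c \<noteq> 0" "(SOME y. y \<in> P) = c *s x"
    using some_in_proj[OF assms(2)] proj_space_rep(2)[OF assms(2,3)] by blast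
  then show ?thesis
    by (simp add: code_coord_def Let_def first_nonzero_scale eval_form_scale[OF assms(1)]
        power_mult_distrib)
qed

lemma hamming_weight_codeword:
  fixes X :: "('a::{field,finite} ^ 'n::{finite,wellorder}) set set"
  assumes "f \<in> quadratic_forms" "X \<subseteq> proj_space"
  shows "hamming_weight X (codeword X f) = card X - card (X \<inter> zero_set f)"
proof -
  have "codeword X f P = 0 \<longleftrightarrow> P \<in> zero_set f" if "P \<in> X" for P
  proof -
    have P: "P \<in> proj_space" using that assms(2) by auto
    have "code_coord f P = 0 \<longleftrightarrow> eval_form f x = 0" if "x \<in> P" for x
      using code_coord_eq[OF assms(1) P that] first_nonzero_neq proj_space_rep(1)[OF P that]
      by auto
    then show ?thesis
      using that P some_in_proj[OF P] by (auto simp: codeword_def zero_set_def)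
  qed
  then have "{P \<in> X. codeword X f P \<noteq> 0} = X - X \<inter> zero_set f" by auto
  then show ?thesis by (simp add: hamming_weight_def card_Diff_subset)
qed

end

theory Submission
  imports Defs
begin

text \<open>
  Everything is counted in the vector space \<open>V = \<bbbF>\<^sub>q\<^sup>5\<close>, where \<open>q = t\<^sup>2\<close>.

  For a pair of hyperplanes the number of points on \<open>\<X>\<close> depends only on the hermitian form on the
  span of the two poles.  It takes five values, and the smallest one belongs to two isotropic poles
  that are not orthogonal.

  Any other quadric \<open>f\<close> has fewer points on \<open>\<X>\<close>.  If its zeros are all singular, they form a
  subspace.  Otherwise some nonsingular zero \<open>u\<close> is not on \<open>\<X>\<close>, since otherwise the conics on the
  quadric would force a totally isotropic subspace of dimension 3.  Unless \<open>f\<close> vanishes on the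
  tangent space at \<open>u\<close>, this tangent space has few zeros of \<open>f\<close> on \<open>\<X>\<close>, because a line through
  \<open>u\<close> meets \<open>\<X>\<close> in at most \<open>t + 1\<close> points.  A line on the quadric through \<open>u\<close> and a second zero \<open>z\<close>
  partitions the \<open>q\<^sup>3\<close> remaining points into \<open>q\<^sup>2\<close> affine lines, and each of these has at most
  \<open>t + 1\<close> points on \<open>\<X>\<close> unless it passes through a point of \<open>\<X>\<close> in whose tangent hyperplane it
  lies.  The lines are counted by averaging over the translations \<open>siegel\<close>, which permute the
  \<open>q\<^sup>3\<close> points.
\<close>

section \<open>Counting by averaging\<close>

text \<open>A quadric has roughly q^4 zero vectors, and roughly one vector in t is isotropic. A
  typical quadric should therefore contain about t^7 isotropic vectors, against about 2 t^7 for a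
  pair of hyperplanes. This factor of two pays for crude estimates: replacing the expected t
  isotropic points on a line by t + 1 costs about t^6, and the exceptional lines, counted as lying
  on the variety entirely, cost about 3 t^6. The resulting bound t^7 + 4 t^6 + ... drops below the
  smallest pair count exactly from t = 4 on, which is where t = 2 and t = 3 are excluded.

  The base point \<open>u\<close> has to avoid the variety because only a nonisotropic direction
  guarantees at most t + 1 isotropic vectors on every line.

  The estimates therefore use lines and averages over permutations, with the form and its polar form
  side by side; only the existence of a second tangent zero is argued separately in even and odd
  characteristic.\<close>

lemma card_fibre_eq:
  assumes fin: "finite A" "finite B" and f: "f ` A \<subseteq> B"
    and le: "\<And>b. b \<in> B \<Longrightarrow> card {x \<in> A. f x = b} \<le> m"
    and ge: "m * card B \<le> card A" and b: "b \<in> B"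
  shows "card {x \<in> A. f x = b} = m"
proof (rule ccontr)
  assume "card {x \<in> A. f x = b} \<noteq> m"
  with le[OF b] have lt: "card {x \<in> A. f x = b} < m" by simp
  have "card A = (\<Sum>b\<in>B. card {x \<in> A. f x = b})"
    using sum.group[OF fin f, of "\<lambda>_. 1::nat"] by simp
  also have "\<dots> < (\<Sum>b\<in>B. m)"
    using le b lt by (intro sum_strict_mono_ex1[OF fin(2)]) auto
  finally show False using ge by (simp add: mult.commute)
qed

lemma card_poly_eq_bound:
  fixes p :: "'a::field poly"
  assumes "p \<noteq> 0" and "degree p \<le> n" and "\<And>x. P x \<Longrightarrow> poly p x = 0"
  shows "card {x. P x} \<le> n"
proof -
  have "card {x. P x} \<le> card {x. poly p x = 0}"
    using assms by (intro card_mono poly_roots_finite) auto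
  also have "\<dots> \<le> n" using card_poly_roots_bound[OF assms(1)] assms(2) by simp
  finally show ?thesis .
qed

lemma card_quadratic_roots_le:
  fixes a b c :: "'a::field"
  assumes "a \<noteq> 0 \<or> b \<noteq> 0"
  shows "card {x. c + x * b + x\<^sup>2 * a = 0} \<le> 2"
  by (rule card_poly_eq_bound[of "[:c, b, a:]"]) (use assms in \<open>auto simp: power2_eq_square algebra_simps\<close>)

text \<open>Double counting of the pairs \<open>(c, p)\<close> with \<open>P (\<tau> c p)\<close>.
  Each \<open>\<tau> c\<close> is injective on a finite set, hence permutes \<open>S\<close>, so
  every \<open>c\<close> contributes the same number. Counting points thereby reduces to solving an
  equation in \<open>c\<close>.\<close>

lemma card_average:
  fixes \<tau> :: "'c::finite \<Rightarrow> 'v \<Rightarrow> 'v"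
  assumes S: "finite S" and inj: "\<And>c. inj_on (\<tau> c) S" and maps: "\<And>c p. p \<in> S \<Longrightarrow> \<tau> c p \<in> S"
  shows "CARD('c) * card {p \<in> S. P p} = (\<Sum>p\<in>S. card {c. P (\<tau> c p)})"
proof -
  have bij: "bij_betw (\<tau> c) S S" for c
    using inj[of c] maps[of _ c] S by (metis bij_betw_def card_image card_subset_eq image_subsetI)
  have "(\<Sum>p\<in>S. card {c. P (\<tau> c p)}) = (\<Sum>p\<in>S. \<Sum>c\<in>UNIV. of_bool (P (\<tau> c p)))"
    by (simp add: of_bool_def flip: sum.inter_filter)
  also have "\<dots> = (\<Sum>c\<in>UNIV. \<Sum>p\<in>S. of_bool (P (\<tau> c p)))" by (rule sum.swap)
  also have "\<dots> = (\<Sum>c\<in>(UNIV :: 'c set). \<Sum>p\<in>S. of_bool (P p))"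
    by (intro sum.cong refl sum.reindex_bij_betw bij)
  also have "\<dots> = CARD('c) * card {p \<in> S. P p}"
    using S by (simp add: of_bool_def flip: sum.inter_filter)
  finally show ?thesis by simp
qed

lemma card_average_le:
  fixes \<tau> :: "'c::finite \<Rightarrow> 'v \<Rightarrow> 'v"
  assumes "finite S" "\<And>c. inj_on (\<tau> c) S" "\<And>c p. p \<in> S \<Longrightarrow> \<tau> c p \<in> S"
    and "\<And>p. p \<in> S \<Longrightarrow> card {c. P (\<tau> c p)} \<le> m"
  shows "CARD('c) * card {p \<in> S. P p} \<le> m * card S"
proof -
  have "(\<Sum>p\<in>S. card {c. P (\<tau> c p)}) \<le> m * card S"
    using sum_bounded_above[of S "\<lambda>p. card {c. P (\<tau> c p)}" m] assms(4) by (simp add: mult.commute)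
  with card_average[of S \<tau> P] assms(1-3) show ?thesis by simp
qed

lemma card_average_eq:
  fixes \<tau> :: "'c::finite \<Rightarrow> 'v \<Rightarrow> 'v"
  assumes "finite S" "\<And>c. inj_on (\<tau> c) S" "\<And>c p. p \<in> S \<Longrightarrow> \<tau> c p \<in> S"
    and "\<And>p. p \<in> S \<Longrightarrow> card {c. P (\<tau> c p)} = m"
  shows "CARD('c) * card {p \<in> S. P p} = m * card S"
  using card_average[of S \<tau> P] assms by simp

lemma sum_if_const:
  "finite A \<Longrightarrow> (\<Sum>x\<in>A. if P x then a else b) = card {x \<in> A. P x} * a + (card A - card {x \<in> A. P x}) * (b::nat)"
proof -
  assume A: "finite A"
  then have "card A - card {x \<in> A. P x} = card {x \<in> A. \<not> P x}"
    using card_Diff_subset[of "{x \<in> A. P x}" A] by (simp add: set_diff_eq) (metis (no_types, lifting) Collect_cong)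
  then show ?thesis using A by (simp add: sum.If_cases Int_def mult.commute)
qed

section \<open>Linear functionals and the sizes of their kernels\<close>

definition linear_fun :: "('a::field ^ 'n \<Rightarrow> 'a) \<Rightarrow> bool" where
  "linear_fun \<phi> \<longleftrightarrow> (\<forall>x y c. \<phi> (x + c *s y) = \<phi> x + c * \<phi> y)"

lemma linear_funD:
  assumes "linear_fun \<phi>"
  shows "\<phi> (x + c *s y) = \<phi> x + c * \<phi> y" "\<phi> 0 = 0" "\<phi> (x + y) = \<phi> x + \<phi> y"
    "\<phi> (c *s y) = c * \<phi> y" "\<phi> (x - y) = \<phi> x - \<phi> y" "\<phi> (- y) = - \<phi> y"
    "\<phi> (x - c *s y) = \<phi> x - c * \<phi> y"
proof -
  have *: "\<And>x c y. \<phi> (x + c *s y) = \<phi> x + c * \<phi> y" using assms by (simp add: linear_fun_def)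
  show "\<phi> (x + c *s y) = \<phi> x + c * \<phi> y" by (rule *)
  show 0: "\<phi> 0 = 0" using *[of 0 0 0] *[of 0 1 0] by (metis add_cancel_right_right mult_1 vec.scale_zero_right add.right_neutral)
  show "\<phi> (x + y) = \<phi> x + \<phi> y" using *[of x 1 y] by simp
  show 1: "\<phi> (c *s y) = c * \<phi> y" for c y using *[of 0 c y] 0 by simp
  show "\<phi> (- y) = - \<phi> y" using 1[of "-1" y] by (simp add: vec.scale_minus_left)
  show "\<phi> (x - y) = \<phi> x - \<phi> y" using *[of x "-1" y] by (simp add: vec.scale_minus_left)
  show "\<phi> (x - c *s y) = \<phi> x - c * \<phi> y" using *[of x "-c" y] by (simp add: vec.scale_minus_left)
qed

lemma subspace_kernel:
  assumes "vec.subspace U" "linear_fun \<phi>"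
  shows "vec.subspace {x \<in> U. \<phi> x = 0}"
  using assms by (auto simp: vec.subspace_def linear_funD[OF assms(2)])

text \<open>Each line in the direction \<open>p\<close> meets the kernel of \<open>\<phi>\<close>
  exactly once, so the kernel indexes these lines and the count is taken line by line.\<close>

lemma card_decompose:
  fixes U :: "('a::{field,finite} ^ 'n) set"
  assumes U: "vec.subspace U" and \<phi>: "linear_fun \<phi>" and p: "p \<in> U" "\<phi> p \<noteq> 0"
  shows "card {x \<in> U. P x} = (\<Sum>e\<in>{x \<in> U. \<phi> x = 0}. card {c. P (e + c *s p)})"
proof -
  let ?K = "{x \<in> U. \<phi> x = 0}"
  have "bij_betw (\<lambda>(e, c). e + c *s p) (SIGMA e:?K. {c. P (e + c *s p)}) {x \<in> U. P x}"
    by (rule bij_betw_byWitness[where f' = "\<lambda>x. (x - (\<phi> x / \<phi> p) *s p, \<phi> x / \<phi> p)"])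
      (use p in \<open>auto simp: linear_funD[OF \<phi>] intro!: vec.subspace_add[OF U] vec.subspace_diff[OF U] vec.subspace_scale[OF U]\<close>)
  then have "card {x \<in> U. P x} = card (SIGMA e:?K. {c. P (e + c *s p)})"
    by (simp add: bij_betw_same_card)
  then show ?thesis by simp
qed

lemma card_kernel:
  fixes U :: "('a::{field,finite} ^ 'n) set"
  assumes U: "vec.subspace U" and \<phi>: "linear_fun \<phi>" and p: "p \<in> U" "\<phi> p \<noteq> 0"
  shows "card U = CARD('a) * card {x \<in> U. \<phi> x = 0}"
  using card_decompose[OF assms, of "\<lambda>_. True"] by simp

text \<open>Takes the place of a dimension count where \<open>\<phi>\<close> may vanish on all of
  \<open>U\<close>.\<close>

lemma card_kernel_ge:
  fixes U :: "('a::{field,finite} ^ 'n) set"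
  assumes U: "vec.subspace U" and \<phi>: "linear_fun \<phi>"
  shows "card U \<le> CARD('a) * card {x \<in> U. \<phi> x = 0}"
proof (cases "\<exists>p\<in>U. \<phi> p \<noteq> 0")
  case True
  then show ?thesis using card_kernel[OF U \<phi>] by auto
next
  case False
  then have "{x \<in> U. \<phi> x = 0} = U" by auto
  then show ?thesis by simp
qed

lemma card_affine_kernel:
  fixes U :: "('a::{field,finite} ^ 'n) set"
  assumes U: "vec.subspace U" and \<phi>: "linear_fun \<phi>" and p: "p \<in> U" "\<phi> p \<noteq> 0"
  shows "card U = CARD('a) * card {x \<in> U. \<phi> x = b}"
proof -
  have "CARD('a) * card {x \<in> U. \<phi> x = b} = 1 * card U"
  proof (rule card_average_eq[where \<tau> = "\<lambda>c x. x + c *s p"])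
    fix x
    have "{c. \<phi> (x + c *s p) = b} = {(b - \<phi> x) / \<phi> p}"
      using p by (auto simp: linear_funD[OF \<phi>] field_simps)
    then show "card {c. \<phi> (x + c *s p) = b} = 1" by simp
  qed (use p in \<open>auto simp: inj_on_def intro!: vec.subspace_add[OF U] vec.subspace_scale[OF U]\<close>)
  then show ?thesis by simp
qed

section \<open>Norm and trace\<close>

locale hermitian_field =
  fixes t :: nat and field_type :: "'a::{field,finite} itself"
  assumes primepow_t: "primepow t" and card_field: "CARD('a) = t\<^sup>2"
begin

lemma t_gt_1: "t > 1"
  using primepow_gt_Suc_0[OF primepow_t] by simp

lemma power_card: "(x::'a) ^ (t\<^sup>2) = x"
proof (cases "x = 0")
  case False
  \<comment> \<open>Multiplication by a nonzero \<open>x\<close> permutes the nonzero elements;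
    cancelling their product gives \<open>x ^ (q - 1) = 1\<close>.\<close>
  have "(\<Prod>y\<in>UNIV - {0}. x * y) = (\<Prod>y\<in>UNIV - {0}. y)"
    by (rule prod.reindex_bij_betw, rule bij_betw_byWitness[where f' = "\<lambda>y. y / x"]) (use False in auto)
  moreover have "(\<Prod>y\<in>UNIV - {0::'a}. y) \<noteq> 0" by simp
  ultimately have "x ^ card (UNIV - {0::'a}) = 1" by (simp add: prod.distrib)
  moreover have "t\<^sup>2 = Suc (card (UNIV - {0::'a}))"
    using t_gt_1 by (simp add: card_field card_Diff_singleton)
  ultimately show ?thesis by (metis mult.right_neutral power_Suc)
qed (use t_gt_1 in simp)

lemma frob_frob [simp]: "((x::'a) ^ t) ^ t = x"
  using power_card[of x] by (simp add: power2_eq_square power_mult)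

lemma frob_add: "((x::'a) + y) ^ t = x ^ t + y ^ t"
proof -
  obtain p k where p: "prime p" "t = p ^ k" using primepow_t by (auto simp: primepow_def)
  have "CHAR('a) > 0" by (rule finite_imp_CHAR_pos) simp
  then have c: "prime CHAR('a)" by (rule prime_CHAR_semidom)
  \<comment> \<open>Translation by 1 permutes the field, so the number of its elements is 0 in it.
    The characteristic thus divides a power of \<open>p\<close> and, being prime, equals
    \<open>p\<close>.\<close>
  have "(\<Sum>x\<in>UNIV. x + (1::'a)) = (\<Sum>x\<in>UNIV. x)"
    by (rule sum.reindex_bij_betw, rule bij_betw_byWitness[where f' = "\<lambda>x. x - 1"]) auto
  then have "of_nat CARD('a) = (0::'a)" by (simp add: sum.distrib)
  moreover have "CARD('a) = p ^ (k * 2)" by (simp add: card_field p(2) power_mult)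
  ultimately have "CHAR('a) dvd p ^ (k * 2)" by (metis of_nat_eq_0_iff_char_dvd)
  then have "CHAR('a) = p" using c p(1) by (metis prime_dvd_power primes_dvd_imp_eq)
  then show ?thesis using freshmans_dream'[OF c, of t k] p(2) by simp
qed

lemma frob_sum: "(sum (f :: 'b \<Rightarrow> 'a) A) ^ t = (\<Sum>i\<in>A. f i ^ t)"
  by (induction A rule: infinite_finite_induct) (use t_gt_1 in \<open>auto simp: frob_add\<close>)

lemma frob_minus: "(- x::'a) ^ t = - (x ^ t)"
proof -
  have "(- x) ^ t + x ^ t = 0 ^ t" using frob_add[of "-x" x] by simp
  then show ?thesis using t_gt_1 by (simp add: eq_neg_iff_add_eq_0)
qed

lemma frob_diff: "((x::'a) - y) ^ t = x ^ t - y ^ t"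
  using frob_add[of x "-y"] by (simp add: frob_minus)

definition subfield :: "'a set" where "subfield = {x. x ^ t = x}"

lemma subfield_0 [simp]: "0 \<in> subfield" using t_gt_1 by (simp add: subfield_def)

lemma norm_in_subfield [simp]: "(x::'a) ^ (t + 1) \<in> subfield"
proof -
  have "(x ^ (t + 1)) ^ t = (x ^ t) ^ t * x ^ t" by (simp add: power_mult_distrib flip: power_mult)
  then show ?thesis by (simp add: subfield_def mult.commute)
qed

lemma card_norm_le: "card {x::'a. x ^ (t + 1) = a} \<le> t + 1"
proof (rule card_poly_eq_bound[of "monom (1::'a) (t + 1) - [:a:]"])
  have "coeff (monom (1::'a) (t + 1) - [:a:]) (t + 1) \<noteq> 0" by simp
  then show "monom (1::'a) (t + 1) - [:a:] \<noteq> 0" by (metis coeff_0)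
  show "degree (monom (1::'a) (t + 1) - [:a:]) \<le> t + 1"
    by (intro degree_diff_le) (simp_all add: degree_monom_le)
qed (simp add: poly_monom)

lemma card_trace_le: "card {x::'a. x + x ^ t = a} \<le> t"
proof (rule card_poly_eq_bound[of "monom (1::'a) t + [:-a, 1:]"])
  have "coeff (monom (1::'a) t + [:-a, 1:]) t \<noteq> 0"
    using t_gt_1 by (cases t) (auto simp: coeff_pCons split: nat.splits)
  then show "monom (1::'a) t + [:-a, 1:] \<noteq> 0" by (metis coeff_0)
  show "degree (monom (1::'a) t + [:-a, 1:]) \<le> t"
    using t_gt_1 by (intro degree_add_le) (simp_all add: degree_monom_le)
qed (auto simp: poly_monom algebra_simps)

lemma card_subfield_le: "card subfield \<le> t"
  unfolding subfield_def
proof (rule card_poly_eq_bound[of "monom (1::'a) t - [:0, 1:]"])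
  have "coeff (monom (1::'a) t - [:0, 1:]) t \<noteq> 0"
    using t_gt_1 by (cases t) (auto simp: coeff_pCons split: nat.splits)
  then show "monom (1::'a) t - [:0, 1:] \<noteq> 0" by (metis coeff_0)
  show "degree (monom (1::'a) t - [:0, 1:]) \<le> t"
    using t_gt_1 by (intro degree_diff_le) (simp_all add: degree_monom_le)
qed (simp add: poly_monom)

text \<open>The degree bound caps each fibre at t + 1, and the \<open>t\<^sup>2 - 1\<close> nonzero
  elements map to at most t - 1 nonzero values. There is no slack, so every fibre is full;
  surjectivity of the norm comes out of the count.\<close>

lemma card_norm:
  assumes "a \<in> subfield" "a \<noteq> 0"
  shows "card {x::'a. x ^ (t + 1) = a} = t + 1"
proof -
  have "card {x \<in> UNIV - {0::'a}. x ^ (t + 1) = a} = t + 1"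
  proof (rule card_fibre_eq[where B = "subfield - {0}"])
    show "(\<lambda>x. x ^ (t + 1)) ` (UNIV - {0}) \<subseteq> subfield - {0}"
      using norm_in_subfield by auto
    show "card {x \<in> UNIV - {0::'a}. x ^ (t + 1) = b} \<le> t + 1" for b
      by (rule order_trans[OF card_mono card_norm_le[of b]]) auto
    have "(t + 1) * card (subfield - {0}) \<le> (t + 1) * (t - 1)"
      using card_subfield_le by (intro mult_left_mono) (auto simp: card_Diff_singleton)
    also have "\<dots> = card (UNIV - {0::'a})"
      using t_gt_1 by (simp add: card_Diff_singleton card_field power2_eq_square algebra_simps)
    finally show "(t + 1) * card (subfield - {0}) \<le> card (UNIV - {0::'a})" .
  qed (use assms in auto)
  moreover have "{x \<in> UNIV - {0::'a}. x ^ (t + 1) = a} = {x. x ^ (t + 1) = a}"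
    using assms by auto
  ultimately show ?thesis by simp
qed

lemma trace_in_subfield [simp]: "(x::'a) + x ^ t \<in> subfield"
  by (simp add: subfield_def frob_add add.commute)

text \<open>The same squeeze as for the norm: \<open>t\<^sup>2\<close> elements, at most t values,
  fibres with at most t elements.\<close>

lemma card_trace:
  assumes "a \<in> subfield"
  shows "card {x::'a. x + x ^ t = a} = t"
proof -
  have "card {x \<in> UNIV. x + x ^ t = a} = t"
  proof (rule card_fibre_eq[where B = subfield])
    have "t * card subfield \<le> t * t" using card_subfield_le by simp
    then show "t * card subfield \<le> card (UNIV :: 'a set)" by (simp add: card_field power2_eq_square)
  qed (use assms card_trace_le in auto)
  then show ?thesis by simp
qed

end

context hermitian_field
begin

subsection \<open>Isotropic vectors\<close>

abbreviation h :: "'a ^ 'n \<Rightarrow> 'a ^ 'n \<Rightarrow> 'a" where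
  "h \<equiv> hermitian_form t"

lemma h_add_left: "h (x + y) z = h x z + h y z"
  by (simp add: hermitian_form_def sum.distrib algebra_simps)

lemma h_scale_left: "h (c *s x) z = c * h x z"
  by (simp add: hermitian_form_def sum_distrib_left algebra_simps)

lemma linear_h: "linear_fun (\<lambda>x. h x y)"
  by (simp add: linear_fun_def h_add_left h_scale_left)

lemma h_add_right: "h x (y + z) = h x y + h x z"
  by (simp add: hermitian_form_def sum.distrib frob_add algebra_simps)

lemma h_scale_right: "h x (c *s y) = c ^ t * h x y"
  by (simp add: hermitian_form_def sum_distrib_left power_mult_distrib algebra_simps)

lemma t_pos [simp]: "t > 0" "t \<noteq> 0" using t_gt_1 by simp_all

lemma h_zero [simp]: "h 0 y = 0" "h y 0 = 0"
  by (auto simp: hermitian_form_def zero_power)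

lemma h_diff_left: "h (x - y) z = h x z - h y z"
  by (rule linear_funD[OF linear_h])

lemma h_diff_right: "h x (y - z) = h x y - h x z"
  by (simp add: hermitian_form_def sum_subtractf frob_diff algebra_simps)

lemma h_sym: "h y x = h x y ^ t"
  by (simp add: hermitian_form_def frob_sum power_mult_distrib mult.commute)

lemma h_eq_0_sym: "h x y = 0 \<longleftrightarrow> h y x = 0"
  using h_sym[of x y] h_sym[of y x] t_gt_1 by auto

lemmas h_simps = h_add_left h_add_right h_scale_left h_scale_right h_diff_left h_diff_right

lemma h_self_in_subfield: "h x x \<in> subfield"
  using h_sym[of x x] by (simp add: subfield_def)

lemma h_axis_right: "h x (axis i 1) = x $ i"
proof -
  have "h x (axis i 1) = (\<Sum>j\<in>UNIV. if j = i then x $ j else 0)"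
    unfolding hermitian_form_def using t_gt_1 by (intro sum.cong) (auto simp: axis_def)
  then show ?thesis by simp
qed

lemma h_nondegenerate: "(\<And>y. h x y = 0) \<Longrightarrow> x = 0"
  by (metis h_axis_right vec_eq_iff zero_index)

text \<open>The cross terms are grouped into the trace of \<open>c * h y x\<close> and the last term
  contains the norm of \<open>c\<close>, because the fibres of trace and norm are known.\<close>

lemma h_self_add: "h (x + c *s y) (x + c *s y) =
    h x x + (c * h y x + (c * h y x) ^ t) + c ^ (t + 1) * h y y"
proof -
  have "(c * h y x) ^ t = c ^ t * h x y" unfolding power_mult_distrib h_sym[of x y, symmetric] ..
  note * = this
  show ?thesis unfolding * by (simp add: h_simps algebra_simps)
qed

lemma h_self_scale: "h (c *s x) (c *s x) = c ^ (t + 1) * h x x"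
  by (simp add: h_simps algebra_simps)

lemma card_roots_nonisotropic_le:
  assumes "h y y \<noteq> 0"
  shows "card {c. h (x + c *s y) (x + c *s y) = 0} \<le> t + 1"
proof (rule card_poly_eq_bound)
  let ?p = "monom (h y y) (t + 1) + (monom (h x y) t + [:h x x, h y x:])"
  have "coeff ?p (t + 1) \<noteq> 0" using assms t_gt_1 by (cases t) auto
  then show "?p \<noteq> 0" by (metis coeff_0)
  show "degree ?p \<le> t + 1"
    using t_gt_1 by (intro degree_add_le order_trans[OF degree_monom_le]) auto
  show "poly ?p c = 0" if "h (x + c *s y) (x + c *s y) = 0" for c
    using that by (simp add: h_simps poly_monom algebra_simps)
qed

text \<open>Scaling \<open>c\<close> by \<open>h y x\<close> turns the condition into a trace
  equation whose right side lies in the subfield.\<close>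

lemma card_roots_isotropic:
  assumes "h y y = 0" and "h y x \<noteq> 0"
  shows "card {c. h (x + c *s y) (x + c *s y) = 0} = t"
proof -
  have "bij_betw (\<lambda>c. c * h y x) {c. h (x + c *s y) (x + c *s y) = 0} {b. b + b ^ t = - h x x}"
    by (rule bij_betw_byWitness[where f' = "\<lambda>b. b / h y x"])
      (use assms in \<open>auto simp: h_self_add eq_neg_iff_add_eq_0 add.commute\<close>)
  then have "card {c. h (x + c *s y) (x + c *s y) = 0} = card {b. b + b ^ t = - h x x}"
    by (rule bij_betw_same_card)
  also have "\<dots> = t"
    using h_self_in_subfield[of x] by (intro card_trace) (simp add: subfield_def frob_minus)
  finally show ?thesis .
qed

text \<open>Orthogonality removes the trace term and leaves a norm equation. Its right side is 0
  exactly when \<open>x\<close> is isotropic, and then \<open>c = 0\<close> is the only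
  solution.\<close>

lemma card_roots_orthogonal:
  assumes "h y y \<noteq> 0" and "h x y = 0"
  shows "card {c. h (x + c *s y) (x + c *s y) = 0} = (if h x x = 0 then 1 else t + 1)"
proof -
  have "h (x + c *s y) (x + c *s y) = 0 \<longleftrightarrow> c ^ (t + 1) = - h x x / h y y" for c
    using assms h_eq_0_sym[of x y] t_gt_1 by (auto simp: h_self_add field_simps eq_neg_iff_add_eq_0 zero_power)
  then have "{c. h (x + c *s y) (x + c *s y) = 0} = {c. c ^ (t + 1) = - h x x / h y y}" by simp
  moreover have "- h x x / h y y \<in> subfield"
    using h_self_in_subfield[of x] h_self_in_subfield[of y]
    by (simp add: subfield_def power_divide frob_minus)
  moreover have "{c::'a. c ^ (t + 1) = 0} = {0}" by auto
  ultimately show ?thesis using assms card_norm[of "- h x x / h y y"] by auto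
qed

section \<open>Isotropic vectors in subspaces\<close>

definition isotropic_count :: "('a ^ 'n) set \<Rightarrow> nat" where
  "isotropic_count U = card {x \<in> U. h x x = 0}"

text \<open>Over each \<open>e\<close> orthogonal to \<open>p\<close>, the line
  \<open>e + c *s p\<close> has 1 isotropic vector if \<open>e\<close> is isotropic and t + 1
  otherwise. The relation is written additively to stay within the natural numbers.\<close>

lemma isotropic_count_nonisotropic:
  assumes U: "vec.subspace U" and p: "p \<in> U" "h p p \<noteq> 0"
  shows "isotropic_count U + t * isotropic_count {x \<in> U. h x p = 0} = (t + 1) * card {x \<in> U. h x p = 0}"
proof -
  let ?E = "{x \<in> U. h x p = 0}"
  have "isotropic_count U = (\<Sum>e\<in>?E. if h e e = 0 then 1 else t + 1)"
    unfolding isotropic_count_def card_decompose[OF U linear_h p]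
    using card_roots_orthogonal[OF p(2)] by (intro sum.cong) auto
  also have "\<dots> = isotropic_count ?E + (card ?E - isotropic_count ?E) * (t + 1)"
    by (subst sum_if_const) (auto simp: isotropic_count_def)
  finally have *: "isotropic_count U = isotropic_count ?E + (card ?E - isotropic_count ?E) * (t + 1)" .
  have "isotropic_count ?E \<le> card ?E" unfolding isotropic_count_def by (intro card_mono) auto
  then obtain d where "card ?E = isotropic_count ?E + d" using le_Suc_ex by blast
  then show ?thesis using * by (simp add: algebra_simps)
qed

text \<open>Off the hyperplane orthogonal to \<open>p\<close>, every line in the direction
  \<open>p\<close> has t isotropic vectors out of t^2, so exactly one vector in t is isotropic
  there.\<close>

lemma isotropic_count_isotropic:
  assumes U: "vec.subspace U" and p: "p \<in> U" "h p p = 0"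
  shows "t * isotropic_count U + card {x \<in> U. h x p = 0} = t * isotropic_count {x \<in> U. h x p = 0} + card U"
proof -
  let ?E = "{x \<in> U. h x p = 0}" and ?S = "{x \<in> U. h x p \<noteq> 0}"
  have "CARD('a) * card {x \<in> ?S. h x x = 0} = t * card ?S"
  proof (rule card_average_eq[where \<tau> = "\<lambda>c x. x + c *s p"])
    show "card {c. h (x + c *s p) (x + c *s p) = 0} = t" if "x \<in> ?S" for x
      using that h_eq_0_sym[of x p] p by (intro card_roots_isotropic) auto
  qed (use p in \<open>auto simp: inj_on_def h_simps intro!: vec.subspace_add[OF U] vec.subspace_scale[OF U]\<close>)
  then have 1: "t * card {x \<in> ?S. h x x = 0} = card ?S"
    using t_gt_1 by (simp add: card_field power2_eq_square)
  have "card U = card (?E \<union> ?S)" by (rule arg_cong[of _ _ card]) auto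
  then have 2: "card U = card ?E + card ?S" by (subst (asm) card_Un_disjoint) auto
  have "isotropic_count U = card ({x \<in> ?E. h x x = 0} \<union> {x \<in> ?S. h x x = 0})"
    unfolding isotropic_count_def by (rule arg_cong[of _ _ card]) auto
  then have "isotropic_count U = isotropic_count ?E + card {x \<in> ?S. h x x = 0}"
    unfolding isotropic_count_def by (subst (asm) card_Un_disjoint) auto
  then show ?thesis using 1 2 by (simp add: algebra_simps)
qed

text \<open>\<open>p\<close> lies in the radical of \<open>U\<close>, so adding multiples of
  \<open>p\<close> preserves isotropy: the isotropic vectors form a cone over those in a complement
  of \<open>p\<close>, and \<open>s\<close> cuts out such a complement.\<close>

lemma isotropic_count_cone:
  assumes U: "vec.subspace U" and p: "p \<in> U" "h p p = 0" and perp: "\<And>x. x \<in> U \<Longrightarrow> h x p = 0"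
    and s: "h p s \<noteq> 0"
  shows "isotropic_count U = CARD('a) * isotropic_count {x \<in> U. h x s = 0}"
proof -
  let ?E = "{x \<in> U. h x s = 0}"
  have "isotropic_count U = (\<Sum>e\<in>?E. if h e e = 0 then CARD('a) else 0)"
    unfolding isotropic_count_def card_decompose[OF U linear_h p(1) s]
  proof (intro sum.cong refl)
    fix e assume "e \<in> ?E"
    then have "h p e = 0" using perp h_eq_0_sym by auto
    then show "card {c. h (e + c *s p) (e + c *s p) = 0} = (if h e e = 0 then CARD('a) else 0)"
      using p by (simp add: h_self_add zero_power)
  qed
  also have "\<dots> = CARD('a) * isotropic_count ?E"
    by (subst sum_if_const) (auto simp: isotropic_count_def)
  finally show ?thesis .
qed

end

lemma int_cancel:
  fixes x :: int
  assumes "x * z + a = b" and "x \<noteq> 0" and "b - a = x * w"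
  shows "z = w"
  using assms by (metis add_diff_cancel_right' mult_left_cancel)

context hermitian_field
begin

text \<open>Coordinate subspaces allow an induction on the dimension inside one vector type.
  Splitting off an axis gives \<open>I (n + 1) = (t + 1) * t ^ (2 * n) - t * I n\<close> for the
  count \<open>I n\<close> in dimension n; the alternating term of the closed form solves this
  recurrence, and the factor t avoids a division.\<close>

lemma isotropic_count_coordinates:
  fixes J :: "'n::finite set"
  defines "U \<equiv> \<lambda>J. {x :: 'a ^ 'n. \<forall>i. i \<notin> J \<longrightarrow> x $ i = 0}"
  shows "card (U J) = CARD('a) ^ card J \<and>
    int t * int (isotropic_count (U J)) = int t ^ (2 * card J) + (int t - 1) * (- int t) ^ card J"
proof (induction J rule: finite_induct[OF finite])
  case 1
  have "U {} = {0}" by (auto simp: U_def vec_eq_iff)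
  moreover have "{x \<in> {0 :: 'a ^ 'n}. h x x = 0} = {0}" by auto
  ultimately show ?case by (simp add: isotropic_count_def)
next
  case (2 j J)
  have sub: "vec.subspace (U (insert j J))" by (auto simp: vec.subspace_def U_def)
  have ax: "axis j 1 \<in> U (insert j J)" "h (axis j 1) (axis j 1) \<noteq> 0"
    by (simp_all add: h_axis_right) (simp_all add: U_def axis_def)
  have E: "{x \<in> U (insert j J). h x (axis j 1) = 0} = U J"
    using 2 by (auto simp: U_def h_axis_right)
  have c: "int (card (U J)) = int t ^ (2 * card J)" using 2 by (simp add: card_field power_mult)
  have "isotropic_count (U (insert j J)) + t * isotropic_count (U J) = (t + 1) * card (U J)"
    using isotropic_count_nonisotropic[OF sub ax] unfolding E .
  then have "int (isotropic_count (U (insert j J))) + int t * int (isotropic_count (U J)) =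
      (int t + 1) * int t ^ (2 * card J)"
    unfolding c[symmetric] by (metis of_nat_add of_nat_mult of_nat_1)
  then have "int (isotropic_count (U (insert j J))) =
      (int t + 1) * int t ^ (2 * card J) - (int t ^ (2 * card J) + (int t - 1) * (- int t) ^ card J)"
    using 2 by simp
  moreover have "card (U (insert j J)) = CARD('a) * card (U J)"
    using card_kernel[OF sub linear_h ax] unfolding E .
  moreover have "int t ^ (2 * card (insert j J)) = int t * int t * int t ^ (2 * card J)"
    "(- int t) ^ card (insert j J) = - int t * (- int t) ^ card J"
    "CARD('a) ^ card (insert j J) = CARD('a) * CARD('a) ^ card J"
    using 2 by simp_all
  ultimately show ?case using 2 by (simp add: left_diff_distrib right_diff_distrib distrib_right distrib_left)
qed

section \<open>Orthogonal complements of one and of two poles\<close>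

abbreviation perp :: "'a ^ 'n \<Rightarrow> ('a ^ 'n) set" where
  "perp r \<equiv> {x. h x r = 0}"

abbreviation perp2 :: "'a ^ 'n \<Rightarrow> 'a ^ 'n \<Rightarrow> ('a ^ 'n) set" where
  "perp2 r s \<equiv> {x. h x r = 0 \<and> h x s = 0}"

lemma subspace_perp: "vec.subspace (perp r)"
  using subspace_kernel[OF vec.subspace_UNIV linear_h[of r]] by simp

lemma subspace_perp2: "vec.subspace (perp2 r s)"
  using subspace_kernel[OF subspace_perp linear_h[of s], of r] by simp

lemma h_nondegenerate_right: "y \<noteq> 0 \<Longrightarrow> \<exists>x. h x y \<noteq> 0"
  using h_nondegenerate[of y] h_eq_0_sym by blast

lemma perp_subset_imp_multiple:
  assumes r: "r \<noteq> 0" and sub: "\<And>x. h x r = 0 \<Longrightarrow> h x s = 0"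
  shows "\<exists>c. s = c *s r"
proof -
  obtain e where e: "h e r \<noteq> 0" using h_nondegenerate_right[OF r] by blast
  \<comment> \<open>The two functionals are proportional. Their ratio is conjugated because
    \<open>h\<close> is semilinear in its second argument.\<close>
  define c where "c = (h e s / h e r) ^ t"
  have "h x (s - c *s r) = 0" for x
  proof -
    have "h (x - (h x r / h e r) *s e) r = 0" using e by (simp add: h_simps)
    from sub[OF this] have "h x s = h x r / h e r * h e s" by (simp add: h_simps)
    then show ?thesis by (simp add: h_simps c_def)
  qed
  then have "s - c *s r = 0" using h_nondegenerate_right[of "s - c *s r"] by blast
  then show ?thesis by auto
qed

text \<open>The case \<open>c = 0\<close> makes \<open>s\<close> nonzero as well. For poles this
  says that the two hyperplanes are distinct.\<close>

definition indep :: "'a ^ 'n \<Rightarrow> 'a ^ 'n \<Rightarrow> bool" where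
  "indep r s \<longleftrightarrow> r \<noteq> 0 \<and> (\<forall>c. s \<noteq> c *s r)"

lemma indep_sym: "indep r s \<Longrightarrow> indep s r"
proof -
  assume a: "indep r s"
  then have "s \<noteq> 0 *s r" unfolding indep_def by blast
  then have s: "s \<noteq> 0" by simp
  have "r \<noteq> c *s s" for c
  proof
    assume r: "r = c *s s"
    then have "c \<noteq> 0" using a by (auto simp: indep_def)
    then have "s = (1 / c) *s r" using r by simp
    then show False using a by (auto simp: indep_def)
  qed
  then show ?thesis using s by (simp add: indep_def)
qed

lemma indep_perp: "indep r s \<Longrightarrow> \<exists>x\<in>perp r. h x s \<noteq> 0"
  using perp_subset_imp_multiple[of r s] by (auto simp: indep_def)

lemma isotropic_count_UNIV: "int (isotropic_count (UNIV :: ('a ^ 5) set)) = int t ^ 9 - int t ^ 5 + int t ^ 4"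
proof -
  have "int t * int (isotropic_count (UNIV :: ('a ^ 5) set)) = int t ^ 10 - (int t - 1) * int t ^ 5"
    using isotropic_count_coordinates[of "UNIV :: 5 set"] by simp
  also have "\<dots> = int t * (int t ^ 9 - int t ^ 5 + int t ^ 4)" by algebra
  finally have "int t * int (isotropic_count (UNIV :: ('a ^ 5) set)) = int t * (int t ^ 9 - int t ^ 5 + int t ^ 4)" .
  then show ?thesis by simp
qed

lemma card_perp:
  fixes r :: "'a ^ 5"
  assumes "r \<noteq> 0"
  shows "card (perp r) = t ^ 8"
proof -
  obtain x where "h x r \<noteq> 0" using h_nondegenerate_right[OF assms] by blast
  then have "card (UNIV :: ('a ^ 5) set) = CARD('a) * card (perp r)"
    using card_kernel[OF vec.subspace_UNIV linear_h, of x r] by simp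
  then have "t ^ 2 * t ^ 8 = t ^ 2 * card (perp r)" by (simp add: card_field flip: power_mult power_add)
  then show ?thesis by (subst (asm) mult_left_cancel) auto
qed

lemma card_perp2:
  fixes r s :: "'a ^ 5"
  assumes i: "indep r s"
  shows "card (perp2 r s) = t ^ 6"
proof -
  obtain x where "x \<in> perp r" "h x s \<noteq> 0" using indep_perp[OF i] by blast
  then have "card (perp r) = CARD('a) * card (perp2 r s)"
    using card_kernel[OF subspace_perp linear_h, of x r s] by simp
  then have "t ^ 2 * t ^ 6 = t ^ 2 * card (perp2 r s)"
    using i card_perp by (simp add: card_field indep_def flip: power_add)
  then show ?thesis by (subst (asm) mult_left_cancel) auto
qed

lemma isotropic_count_perp:
  fixes r :: "'a ^ 5"
  assumes "r \<noteq> 0"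
  shows "int (isotropic_count (perp r)) =
    (if h r r = 0 then int t ^ 7 - int t ^ 5 + int t ^ 4 else int t ^ 7 + int t ^ 4 - int t ^ 3)"
proof -
  let ?z = "int (isotropic_count (perp r))"
  have c: "card (UNIV :: ('a ^ 5) set) = t ^ 10" by (simp add: card_field flip: power_mult)
  show ?thesis
  proof (cases "h r r = 0")
    case True
    then have N: "t * isotropic_count (UNIV :: ('a ^ 5) set) + t ^ 8 = t * isotropic_count (perp r) + t ^ 10"
      using isotropic_count_isotropic[OF vec.subspace_UNIV, of r] card_perp[OF assms] c by simp
    have eq: "int t * ?z + int t ^ 10 = int t * (int t ^ 9 - int t ^ 5 + int t ^ 4) + int t ^ 8"
      using arg_cong[OF N, of int]
      by (simp only: isotropic_count_UNIV of_nat_add of_nat_mult of_nat_power of_nat_1 add.commute)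
    have "?z = int t ^ 7 - int t ^ 5 + int t ^ 4"
      by (rule int_cancel[OF eq]) (simp, algebra)
    then show ?thesis using True by simp
  next
    case False
    then have N: "isotropic_count (UNIV :: ('a ^ 5) set) + t * isotropic_count (perp r) = (t + 1) * t ^ 8"
      using isotropic_count_nonisotropic[OF vec.subspace_UNIV, of r] card_perp[OF assms] by simp
    have eq: "int t * ?z + (int t ^ 9 - int t ^ 5 + int t ^ 4) = (int t + 1) * int t ^ 8"
      using arg_cong[OF N, of int]
      by (simp only: isotropic_count_UNIV of_nat_add of_nat_mult of_nat_power of_nat_1 add.commute)
    have "?z = int t ^ 7 + int t ^ 4 - int t ^ 3"
      by (rule int_cancel[OF eq]) (simp, algebra)
    then show ?thesis using False by simp
  qed
qed

text \<open>Replacing \<open>s\<close> by its component \<open>w\<close> orthogonal to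
  \<open>r\<close> does not change \<open>perp2 r s\<close>. Up to the factor \<open>h r r\<close>,
  the value \<open>h w w\<close> is the Gram determinant of \<open>r\<close> and \<open>s\<close>,
  which the case distinction tests.\<close>

lemma isotropic_count_perp2_nonisotropic:
  fixes r s :: "'a ^ 5"
  assumes i: "indep r s" and r: "h r r \<noteq> 0"
  shows "int (isotropic_count (perp2 r s)) =
    (if h r r * h s s = h r s * h s r then int t ^ 5 + int t ^ 4 - int t ^ 3 else int t ^ 5 - int t ^ 3 + int t ^ 2)"
proof -
  let ?z = "int (isotropic_count (perp2 r s))"
  define c where "c = h s r / h r r"
  define w where "w = s - c *s r"
  have wr: "h w r = 0" "h r w = 0" using r h_eq_0_sym[of w r] by (auto simp: w_def c_def h_simps)
  have "h w w = h w s" using h_diff_right[of w s "c *s r"] wr by (simp add: h_scale_right flip: w_def)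
  then have ww: "h w w = (h r r * h s s - h r s * h s r) / h r r"
    using r by (simp add: w_def c_def h_simps field_simps)
  have w0: "w \<noteq> 0" using i by (auto simp: w_def indep_def)
  have E: "perp2 r s = {x \<in> perp r. h x w = 0}" "perp2 r s = {x \<in> perp w. h x r = 0}"
    by (auto simp: w_def h_simps)
  have r0: "r \<noteq> 0" using i by (simp add: indep_def)
  show ?thesis
  \<comment> \<open>Either way \<open>perp2 r s\<close> is cut by a nonisotropic vector out of a
    hyperplane with known count: by \<open>r\<close> out of \<open>perp w\<close> if
    \<open>w\<close> is isotropic, by \<open>w\<close> out of \<open>perp r\<close>
    otherwise.\<close>
  proof (cases "h w w = 0")
    case True
    have N: "isotropic_count (perp w) + t * isotropic_count (perp2 r s) = (t + 1) * t ^ 6"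
      using isotropic_count_nonisotropic[OF subspace_perp _ r, of w] wr card_perp2[OF i]
      unfolding E(2) by simp
    have eq: "int t * ?z + (int t ^ 7 - int t ^ 5 + int t ^ 4) = (int t + 1) * int t ^ 6"
      using arg_cong[OF N, of int] True
      by (simp only: isotropic_count_perp[OF w0] if_True if_False simp_thms of_nat_add of_nat_mult of_nat_power of_nat_1 add.commute add_0_right)
    have "?z = int t ^ 5 + int t ^ 4 - int t ^ 3"
      by (rule int_cancel[OF eq]) (simp, algebra)
    then show ?thesis using True ww r by simp
  next
    case False
    have N: "isotropic_count (perp r) + t * isotropic_count (perp2 r s) = (t + 1) * t ^ 6"
      using isotropic_count_nonisotropic[OF subspace_perp _ False, of r] wr card_perp2[OF i]
      unfolding E(1) by simp
    have eq: "int t * ?z + (int t ^ 7 + int t ^ 4 - int t ^ 3) = (int t + 1) * int t ^ 6"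
      using arg_cong[OF N, of int] r
      by (simp only: isotropic_count_perp[OF r0] if_True if_False simp_thms of_nat_add of_nat_mult of_nat_power of_nat_1 add.commute add_0_right)
    have "?z = int t ^ 5 - int t ^ 3 + int t ^ 2"
      by (rule int_cancel[OF eq]) (simp, algebra)
    then show ?thesis using False ww r by simp
  qed
qed

text \<open>If the poles are orthogonal, \<open>r\<close> lies in \<open>perp s\<close> and the
  lines in its direction relate the two counts. Otherwise \<open>perp r\<close> is a cone with
  vertex \<open>r\<close>, and \<open>s\<close> cuts out a base of it.\<close>

lemma isotropic_count_perp2_isotropic:
  fixes r s :: "'a ^ 5"
  assumes i: "indep r s" and r: "h r r = 0" "h s s = 0"
  shows "int (isotropic_count (perp2 r s)) =
    (if h r s = 0 then int t ^ 4 else int t ^ 5 - int t ^ 3 + int t ^ 2)"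
proof -
  let ?z = "int (isotropic_count (perp2 r s))"
  have r0: "r \<noteq> 0" and s0: "s \<noteq> 0" using i indep_sym[OF i] by (simp_all add: indep_def)
  have E: "perp2 r s = {x \<in> perp r. h x s = 0}" "perp2 r s = {x \<in> perp s. h x r = 0}" by auto
  show ?thesis
  proof (cases "h r s = 0")
    case True
    have N: "t * isotropic_count (perp s) + t ^ 6 = t * isotropic_count (perp2 r s) + t ^ 8"
      using isotropic_count_isotropic[OF subspace_perp _ r(1), of s] True card_perp2[OF i] card_perp[OF s0]
      unfolding E(2) by simp
    have eq: "int t * ?z + int t ^ 8 = int t * (int t ^ 7 - int t ^ 5 + int t ^ 4) + int t ^ 6"
      using arg_cong[OF N, of int] r
      by (simp only: isotropic_count_perp[OF s0] if_True if_False simp_thms of_nat_add of_nat_mult of_nat_power of_nat_1 add.commute add_0_right)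
    have "?z = int t ^ 4"
      by (rule int_cancel[OF eq]) (simp, algebra)
    then show ?thesis using True by simp
  next
    case False
    have N: "isotropic_count (perp r) = t\<^sup>2 * isotropic_count (perp2 r s)"
      unfolding E(1) card_field[symmetric]
      by (rule isotropic_count_cone[OF subspace_perp, where p = r]) (use r False in auto)
    have eq: "int t ^ 2 * ?z + 0 = int t ^ 7 - int t ^ 5 + int t ^ 4"
      using arg_cong[OF N, of int] r
      by (simp only: isotropic_count_perp[OF r0] if_True if_False simp_thms of_nat_add of_nat_mult of_nat_power of_nat_1 add.commute add_0_right)
    have "?z = int t ^ 5 - int t ^ 3 + int t ^ 2"
      by (rule int_cancel[OF eq]) (simp, algebra)
    then show ?thesis using False by simp
  qed
qed

text \<open>Inclusion and exclusion for the two hyperplanes. The second and third case agree, so six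
  cases give five values. The first value is the smallest, and all other quadrics have to stay below
  it.\<close>

lemma isotropic_count_pair:
  fixes r s :: "'a ^ 5"
  assumes i: "indep r s"
  defines "z \<equiv> int (isotropic_count {x. h x r = 0 \<or> h x s = 0})"
  shows "h r r = 0 \<Longrightarrow> h s s = 0 \<Longrightarrow> h r s \<noteq> 0 \<Longrightarrow>
      z = 2 * int t ^ 7 - 3 * int t ^ 5 + 2 * int t ^ 4 + int t ^ 3 - int t ^ 2"
    and "h r r = 0 \<Longrightarrow> h s s = 0 \<Longrightarrow> h r s = 0 \<Longrightarrow> z = 2 * int t ^ 7 - 2 * int t ^ 5 + int t ^ 4"
    and "h r r \<noteq> 0 \<Longrightarrow> h s s = 0 \<Longrightarrow> h r s = 0 \<Longrightarrow> z = 2 * int t ^ 7 - 2 * int t ^ 5 + int t ^ 4"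
    and "h r r \<noteq> 0 \<Longrightarrow> h s s = 0 \<Longrightarrow> h r s \<noteq> 0 \<Longrightarrow>
      z = 2 * int t ^ 7 - 2 * int t ^ 5 + 2 * int t ^ 4 - int t ^ 2"
    and "h r r \<noteq> 0 \<Longrightarrow> h s s \<noteq> 0 \<Longrightarrow> h r r * h s s = h r s * h s r \<Longrightarrow>
      z = 2 * int t ^ 7 - int t ^ 5 + int t ^ 4 - int t ^ 3"
    and "h r r \<noteq> 0 \<Longrightarrow> h s s \<noteq> 0 \<Longrightarrow> h r r * h s s \<noteq> h r s * h s r \<Longrightarrow>
      z = 2 * int t ^ 7 - int t ^ 5 + 2 * int t ^ 4 - int t ^ 3 - int t ^ 2"
proof -
  have r0: "r \<noteq> 0" and s0: "s \<noteq> 0" using i indep_sym[OF i] by (simp_all add: indep_def)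
  let ?R = "{x \<in> perp r. h x x = 0}" and ?S = "{x \<in> perp s. h x x = 0}"
  have "{x \<in> {x. h x r = 0 \<or> h x s = 0}. h x x = 0} = ?R \<union> ?S" by auto
  moreover have "?R \<inter> ?S = {x \<in> perp2 r s. h x x = 0}" by auto
  ultimately have "isotropic_count (perp r) + isotropic_count (perp s) =
      isotropic_count {x. h x r = 0 \<or> h x s = 0} + isotropic_count (perp2 r s)"
    unfolding isotropic_count_def using card_Un_Int[of ?R ?S] by simp
  then have z: "z = int (isotropic_count (perp r)) + int (isotropic_count (perp s)) - int (isotropic_count (perp2 r s))"
    unfolding z_def by linarith
  show "h r r = 0 \<Longrightarrow> h s s = 0 \<Longrightarrow> h r s \<noteq> 0 \<Longrightarrow>
      z = 2 * int t ^ 7 - 3 * int t ^ 5 + 2 * int t ^ 4 + int t ^ 3 - int t ^ 2"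
    and "h r r = 0 \<Longrightarrow> h s s = 0 \<Longrightarrow> h r s = 0 \<Longrightarrow> z = 2 * int t ^ 7 - 2 * int t ^ 5 + int t ^ 4"
    unfolding z isotropic_count_perp[OF r0] isotropic_count_perp[OF s0]
    using isotropic_count_perp2_isotropic[OF i] by simp_all
  show "h r r \<noteq> 0 \<Longrightarrow> h s s = 0 \<Longrightarrow> h r s = 0 \<Longrightarrow> z = 2 * int t ^ 7 - 2 * int t ^ 5 + int t ^ 4"
    and "h r r \<noteq> 0 \<Longrightarrow> h s s = 0 \<Longrightarrow> h r s \<noteq> 0 \<Longrightarrow>
      z = 2 * int t ^ 7 - 2 * int t ^ 5 + 2 * int t ^ 4 - int t ^ 2"
    and "h r r \<noteq> 0 \<Longrightarrow> h s s \<noteq> 0 \<Longrightarrow> h r r * h s s = h r s * h s r \<Longrightarrow>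
      z = 2 * int t ^ 7 - int t ^ 5 + int t ^ 4 - int t ^ 3"
    and "h r r \<noteq> 0 \<Longrightarrow> h s s \<noteq> 0 \<Longrightarrow> h r r * h s s \<noteq> h r s * h s r \<Longrightarrow>
      z = 2 * int t ^ 7 - int t ^ 5 + 2 * int t ^ 4 - int t ^ 3 - int t ^ 2"
    unfolding z isotropic_count_perp[OF r0] isotropic_count_perp[OF s0]
    using isotropic_count_perp2_nonisotropic[OF i] h_eq_0_sym[of r s] by simp_all
qed

end

section \<open>Quadrics\<close>

text \<open>The polar form \<open>B\<close> accompanies \<open>f\<close> and cannot replace it:
  \<open>B x x = 2 * f x\<close>, which in characteristic 2 loses the values of
  \<open>f\<close>.\<close>

locale quadratic_map =
  fixes f :: "'a::field ^ 'n \<Rightarrow> 'a" and B :: "'a ^ 'n \<Rightarrow> 'a ^ 'n \<Rightarrow> 'a"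
  assumes f_zero [simp]: "f 0 = 0"
    and f_add_scale: "f (x + c *s y) = f x + c * B x y + c\<^sup>2 * f y"
    and linear_B: "linear_fun (\<lambda>x. B x y)"
    and B_sym: "B x y = B y x"
begin

lemma B_add: "B (x + y) z = B x z + B y z" "B z (x + y) = B z x + B z y"
  using linear_funD(3)[OF linear_B] B_sym[of z] by auto

lemma B_scale: "B (c *s x) z = c * B x z" "B z (c *s x) = c * B z x"
  using linear_funD(4)[OF linear_B] B_sym[of z] by auto

lemma B_diff: "B (x - y) z = B x z - B y z" "B z (x - y) = B z x - B z y"
  using linear_funD(5)[OF linear_B] B_sym[of z] by auto

lemma linear_B_right: "linear_fun (B x)"
  by (simp add: linear_fun_def B_add B_scale)

lemma B_zero [simp]: "B 0 x = 0" "B x 0 = 0"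
  using linear_funD(2)[OF linear_B] B_sym[of x 0] by auto

lemmas B_simps = B_add B_scale B_diff

lemma f_scale: "f (c *s x) = c\<^sup>2 * f x"
  using f_add_scale[of 0 c x] by simp

lemma f_add: "f (x + y) = f x + B x y + f y"
  using f_add_scale[of x 1 y] by simp

lemma f_diff_scale: "f (x - c *s y) = f x - c * B x y + c\<^sup>2 * f y"
  using f_add_scale[of x "-c" y] by (simp add: vec.scale_minus_left)

lemma B_self: "B x x = 2 * f x"
  using f_add[of x x] f_scale[of 2 x] by (simp add: vec.scale_left_distrib[of 1 1 x, simplified] algebra_simps)

text \<open>The Siegel (or Eichler) transformation, restricted to zeros \<open>p\<close> with
  \<open>B u p = 1\<close> and to \<open>w\<close> with \<open>B u w = 0\<close>. There
  \<open>f (p + w) = B p w + f w\<close>, and subtracting \<open>c *s u\<close> lowers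
  \<open>f\<close> by \<open>c\<close>, so the last term restores a zero.\<close>

definition siegel :: "'a ^ 'n \<Rightarrow> 'a ^ 'n \<Rightarrow> 'a ^ 'n \<Rightarrow> 'a ^ 'n" where
  "siegel u w p = p + w - (B p w + f w) *s u"

end

section \<open>A quadric seen from a nonsingular zero\<close>

locale pointed_quadric = quadratic_map f B
  for f :: "'a::field ^ 'n \<Rightarrow> 'a" and B +
  fixes u p\<^sub>0 :: "'a ^ 'n"
  assumes fu [simp]: "f u = 0" and fp0 [simp]: "f p\<^sub>0 = 0" and Bup0 [simp]: "B u p\<^sub>0 = 1"
begin

lemma Buu [simp]: "B u u = 0" by (simp add: B_self)

text \<open>Each zero of \<open>f\<close> off the tangent space at \<open>u\<close> has exactly one
  multiple in this set: it is the affine chart of the quadric outside that tangent space.\<close>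

definition affine_part :: "('a ^ 'n) set" where
  "affine_part = {p. f p = 0 \<and> B u p = 1}"

definition tangent_space :: "('a ^ 'n) set" where
  "tangent_space = {x. B u x = 0}"

lemma siegel_affine_part:
  assumes "w \<in> tangent_space" "p \<in> affine_part"
  shows "siegel u w p \<in> affine_part"
proof -
  have "f (siegel u w p) = f (p + w) - (B p w + f w) * B (p + w) u + (B p w + f w)\<^sup>2 * f u"
    unfolding siegel_def by (rule f_diff_scale)
  then show ?thesis
    using assms B_sym[of p u] B_sym[of w u]
    by (simp add: affine_part_def tangent_space_def f_add B_add) (simp add: siegel_def B_simps)
qed

text \<open>Two points with the same image differ by a multiple of \<open>u\<close>. As
  \<open>B u w = 0\<close>, both then have the same correction term and coincide.\<close>

lemma inj_siegel:
  assumes "w \<in> tangent_space"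
  shows "inj_on (siegel u w) S"
proof (rule inj_onI)
  fix p p' assume "siegel u w p = siegel u w p'"
  then have *: "p - p' = (B p w - B p' w) *s u"
    by (simp add: siegel_def algebra_simps vec.scale_left_diff_distrib)
  have "B (p - p') w = 0"
    unfolding * using assms by (simp add: B_simps tangent_space_def)
  then have "B p w = B p' w" by (simp add: B_simps)
  with * show "p = p'" by simp
qed

lemma scale_tangent_space: "w \<in> tangent_space \<Longrightarrow> c *s w \<in> tangent_space"
  by (simp add: tangent_space_def B_simps)

lemma subspace_tangent_space: "vec.subspace tangent_space"
  using subspace_kernel[OF vec.subspace_UNIV linear_B_right[of u]] by (simp add: tangent_space_def)

lemma B_siegel: "w \<in> tangent_space \<Longrightarrow> z \<in> tangent_space \<Longrightarrow> B (siegel u w p) z = B p z + B w z"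
  by (simp add: siegel_def B_simps tangent_space_def)

lemma decomposition: "\<exists>w\<in>tangent_space. x = B u x *s p\<^sub>0 + w"
  by (rule bexI[of _ "x - B u x *s p\<^sub>0"]) (simp_all add: tangent_space_def B_simps)

text \<open>Subtracting \<open>B u x *s p\<^sub>0\<close> moves \<open>x\<close> into the tangent
  space, and expanding \<open>f\<close> at the result factors out \<open>B u x\<close>. These are
  the quadrics that the strict estimate leaves over.\<close>

lemma product_if_zero_on_tangent_space:
  assumes "\<And>w. w \<in> tangent_space \<Longrightarrow> f w = 0"
  shows "f x = B u x * B p\<^sub>0 x"
proof -
  define w where "w = x - B u x *s p\<^sub>0"
  have "f w = 0" by (rule assms) (simp add: w_def tangent_space_def B_simps)
  then have "f x = B u x * B x p\<^sub>0" by (simp add: w_def f_diff_scale)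
  then show ?thesis by (simp add: B_sym)
qed

end

locale finite_pointed_quadric = pointed_quadric f B u p\<^sub>0
  for f :: "'a::{field,finite} ^ 5 \<Rightarrow> 'a" and B u p\<^sub>0
begin

lemma card_tangent_space: "card tangent_space = CARD('a) ^ 4"
proof -
  have "card (UNIV :: ('a ^ 5) set) = CARD('a) * card tangent_space"
    using card_kernel[OF vec.subspace_UNIV linear_B_right, of p\<^sub>0 u] by (simp add: tangent_space_def)
  then have "CARD('a) * CARD('a) ^ 4 = CARD('a) * card tangent_space" by (simp flip: power_Suc)
  then show ?thesis by simp
qed

text \<open>On the affine hyperplane \<open>B u p = 1\<close>, adding \<open>c *s u\<close> adds
  \<open>c\<close> to \<open>f\<close>, so exactly one translate in q is a zero.\<close>

lemma card_affine_part: "card affine_part = CARD('a) ^ 3"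
proof -
  have "card (UNIV :: ('a ^ 5) set) = CARD('a) * card {p. B u p = 1}"
    using card_affine_kernel[OF vec.subspace_UNIV linear_B_right, of p\<^sub>0 u 1] by simp
  then have "CARD('a) * CARD('a) ^ 4 = CARD('a) * card {p. B u p = 1}" by (simp flip: power_Suc)
  then have 1: "card {p. B u p = 1} = CARD('a) ^ 4" by simp
  have "CARD('a) * card {p \<in> {p. B u p = 1}. f p = 0} = 1 * card {p. B u p = 1}"
  proof (rule card_average_eq[where \<tau> = "\<lambda>c p. p + c *s u"])
    fix p assume "p \<in> {p. B u p = 1}"
    then have "{c. f (p + c *s u) = 0} = {- f p}"
      by (auto simp: f_add_scale B_sym[of p u] eq_neg_iff_add_eq_0 add.commute)
    then show "card {c. f (p + c *s u) = 0} = 1" by simp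
  qed (auto simp: inj_on_def B_simps)
  moreover have "{p \<in> {p. B u p = 1}. f p = 0} = affine_part" by (auto simp: affine_part_def)
  ultimately have "CARD('a) * card affine_part = CARD('a) * CARD('a) ^ 3" using 1 by (simp flip: power_Suc)
  then show ?thesis by simp
qed

lemma card_scaled_affine_part:
  fixes P :: "'a ^ 5 \<Rightarrow> bool"
  assumes P: "\<And>c x. c \<noteq> 0 \<Longrightarrow> P (c *s x) \<longleftrightarrow> P x"
  shows "card {x. f x = 0 \<and> P x} =
    card {x \<in> tangent_space. f x = 0 \<and> P x} + (CARD('a) - 1) * card {p \<in> affine_part. P p}"
proof -
  let ?A = "{x \<in> tangent_space. f x = 0 \<and> P x}" and ?C = "{x. f x = 0 \<and> P x \<and> B u x \<noteq> 0}"
  have "{x. f x = 0 \<and> P x} = ?A \<union> ?C" by (auto simp: tangent_space_def)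
  then have "card {x. f x = 0 \<and> P x} = card ?A + card ?C"
    by (simp add: card_Un_disjoint disjoint_iff tangent_space_def)
  moreover have "bij_betw (\<lambda>(c, p). c *s p) ((UNIV - {0}) \<times> {p \<in> affine_part. P p}) ?C"
    by (rule bij_betw_byWitness[where f' = "\<lambda>x. (B u x, (1 / B u x) *s x)"])
      (auto simp: affine_part_def B_simps f_scale P)
  then have "card ?C = (CARD('a) - 1) * card {p \<in> affine_part. P p}"
    by (simp add: bij_betw_same_card[symmetric] card_cartesian_product card_Diff_singleton)
  ultimately show ?thesis by simp
qed

lemma card_tangent_zeros_le:
  assumes w: "w \<in> tangent_space" "f w \<noteq> 0"
  shows "card {x \<in> tangent_space. f x = 0} \<le> 2 * CARD('a) ^ 3"
proof -
  have "CARD('a) * card {x \<in> tangent_space. f x = 0} \<le> 2 * card tangent_space"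
  proof (rule card_average_le[where \<tau> = "\<lambda>c x. x + c *s w"])
    show "card {c. f (x + c *s w) = 0} \<le> 2" for x
      using card_quadratic_roots_le[of "f w" "B x w" "f x"] w by (simp add: f_add_scale)
  qed (use w in \<open>auto simp: inj_on_def tangent_space_def B_simps\<close>)
  also have "\<dots> = CARD('a) * (2 * CARD('a) ^ 3)" by (simp add: card_tangent_space eval_nat_numeral algebra_simps)
  finally show ?thesis by simp
qed

definition multiples :: "('a ^ 5) set" where "multiples = range (\<lambda>c. c *s u)"

lemma card_multiples_le: "card multiples \<le> CARD('a)"
  unfolding multiples_def by (rule card_image_le) simp

lemma ex_not_multiple:
  assumes "card S > CARD('a)"
  shows "\<exists>x\<in>S. x \<notin> multiples"
proof (rule ccontr)
  assume "\<not> ?thesis"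
  then have "card S \<le> card multiples" by (intro card_mono) auto
  with assms card_multiples_le show False by simp
qed

lemma card_field_gt_1: "CARD('a) > 1"
proof -
  have "card {0::'a, 1} \<le> CARD('a)" by (intro card_mono) auto
  then show ?thesis by simp
qed

text \<open>Chevalley's theorem for the ternary form that \<open>f\<close> induces on the quotient of the tangent
  space by the vertex \<open>u\<close>.\<close>

lemma ex_tangent_zero: "\<exists>z\<in>tangent_space. f z = 0 \<and> z \<notin> multiples"
proof (rule ccontr)
  assume "\<not> ?thesis"
  then have aniso: "\<And>z. z \<in> tangent_space \<Longrightarrow> f z = 0 \<Longrightarrow> z \<in> multiples" by blast
  let ?q = "CARD('a)"
  have q: "?q > 1" by (rule card_field_gt_1)
  have "?q < ?q ^ 4" using q power_strict_increasing[of 1 4 ?q] by simp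
  then obtain w1 where w1: "w1 \<in> tangent_space" "w1 \<notin> multiples"
    using ex_not_multiple[of tangent_space] by (auto simp: card_tangent_space)
  define N where "N = {x \<in> tangent_space. B w1 x = 0}"
  have N: "vec.subspace N" unfolding N_def by (intro subspace_kernel subspace_tangent_space linear_B_right)
  have "?q ^ 4 \<le> ?q * card N"
    unfolding N_def card_tangent_space[symmetric] by (intro card_kernel_ge subspace_tangent_space linear_B_right)
  then have cN: "?q ^ 3 \<le> card N" by (simp add: eval_nat_numeral)
  show False
  proof (cases "(2::'a) = 0")
    \<comment> \<open>Every element is a square here. For \<open>w2\<close> orthogonal to
      \<open>w1\<close> the equation \<open>f (w2 + c *s w1) = 0\<close> only fixes the square of
      \<open>c\<close>, hence is solvable. Taking \<open>w2\<close> outside the span of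
      \<open>u\<close> and \<open>w1\<close> keeps the zero from being a multiple of
      \<open>u\<close>.\<close>
    case two: True
    have inj: "inj_on (\<lambda>y::'a. y\<^sup>2) UNIV"
    proof (rule inj_onI)
      fix x y :: 'a assume "x\<^sup>2 = y\<^sup>2"
      then have "(x - y)\<^sup>2 = 2 * (y * (y - x))" by (simp add: power2_eq_square algebra_simps)
      then show "x = y" using two by simp
    qed
    then have surj: "surj (\<lambda>y::'a. y\<^sup>2)" by (simp add: finite_UNIV_inj_surj)
    have f1: "f w1 \<noteq> 0" using aniso w1 by blast
    define G where "G = (\<lambda>(a, b). a *s u + b *s w1) ` (UNIV :: ('a \<times> 'a) set)"
    have "card G \<le> ?q ^ 2"
      unfolding G_def by (rule order_trans[OF card_image_le]) (simp_all add: card_cartesian_product power2_eq_square)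
    also have "\<dots> < ?q ^ 3" using q by (intro power_strict_increasing) auto
    finally have "card G < card N" using cN by simp
    then have "\<not> N \<subseteq> G" by (meson card_mono finite_code leD)
    then obtain w2 where w2: "w2 \<in> N" "w2 \<notin> G" by blast
    obtain c where c: "c\<^sup>2 = - f w2 / f w1" using surj by (metis surjD)
    have "f (w2 + c *s w1) = 0"
      using w2 f1 by (simp add: f_add_scale c N_def B_sym[of w2 w1])
    moreover have "w2 + c *s w1 \<in> tangent_space"
      using w1 w2 by (simp add: N_def tangent_space_def B_simps)
    ultimately obtain d where d: "w2 + c *s w1 = d *s u" using aniso by (auto simp: multiples_def)
    have "w2 = d *s u + (- c) *s w1" unfolding d[symmetric] by (simp add: vec.scale_minus_left)
    then have "w2 \<in> G" unfolding G_def by (intro image_eqI[of _ _ "(d, - c)"]) auto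
    then show False using w2(2) by simp
  next
    case two: False
    define G where "G = (\<lambda>(a, b). a *s u + b *s w1) ` (UNIV :: ('a \<times> 'a) set)"
    have "card G \<le> ?q ^ 2"
      unfolding G_def by (rule order_trans[OF card_image_le]) (simp_all add: card_cartesian_product power2_eq_square)
    also have "\<dots> < ?q ^ 4" using q by (intro power_strict_increasing) auto
    finally have "card G < card tangent_space" by (simp add: card_tangent_space)
    then have "\<not> tangent_space \<subseteq> G" by (meson card_mono finite_code leD)
    then obtain w2 where w2: "w2 \<in> tangent_space" "w2 \<notin> G" by blast
    have "card N \<le> ?q * card {x \<in> N. B w2 x = 0}" by (intro card_kernel_ge N linear_B_right)
    moreover have "?q ^ 3 = ?q * ?q ^ 2" by (simp add: eval_nat_numeral)
    ultimately have "?q * ?q ^ 2 \<le> ?q * card {x \<in> N. B w2 x = 0}" using cN by linarith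
    then have "?q ^ 2 \<le> card {x \<in> N. B w2 x = 0}" by simp
    moreover have "?q < ?q ^ 2" using q by (simp add: power2_eq_square)
    ultimately have "card {x \<in> N. B w2 x = 0} > ?q" by linarith
    then obtain w3 where w3: "w3 \<in> tangent_space" "B w1 w3 = 0" "B w2 w3 = 0" "w3 \<notin> multiples"
      using ex_not_multiple by (fastforce simp: N_def)
    have f1: "f w1 \<noteq> 0" and f3: "f w3 \<noteq> 0" using aniso w1 w3 by blast+
    \<comment> \<open>A quadratic polynomial takes at least q / 2 values. The second set has more
      than q / 2 elements because its value 0 is taken only once. So the two sets meet, and by the
      orthogonality of \<open>w3\<close> a common value yields a zero.\<close>
    let ?S = "range (\<lambda>x. f (w2 + x *s w1))" and ?T = "range (\<lambda>y. - (y\<^sup>2 * f w3))"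
    have two_to_one: "?q \<le> 2 * card (range g)"
      if "\<And>b. card {x. g x = b} \<le> 2" for g :: "'a \<Rightarrow> 'a"
    proof -
      have "?q = (\<Sum>b\<in>range g. card {x \<in> UNIV. g x = b})"
        using sum.group[of UNIV "range g" g "\<lambda>_. 1::nat"] by simp
      also have "\<dots> \<le> (\<Sum>b\<in>range g. 2)" using that by (intro sum_mono) simp
      finally show ?thesis by simp
    qed
    have "card {x. f (w2 + x *s w1) = b} \<le> 2" for b
      using card_quadratic_roots_le[of "f w1" "B w2 w1" "f w2 - b"] f1
      by (simp add: f_add_scale algebra_simps)
    then have cS: "?q \<le> 2 * card ?S" by (rule two_to_one)
    have "{y. - (y\<^sup>2 * f w3) = b} = {y. b + y * 0 + y\<^sup>2 * f w3 = 0}" for b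
      by (auto simp: eq_neg_iff_add_eq_0 neg_eq_iff_add_eq_0 add.commute)
    then have "card {y. - (y\<^sup>2 * f w3) = b} \<le> 2" for b
      using card_quadratic_roots_le[of "f w3" 0 b] f3 by simp
    moreover have "{y. - (y\<^sup>2 * f w3) = 0} = {0}" using f3 by auto
    then have "card {y. - (y\<^sup>2 * f w3) = 0} < 2" by (simp only:) simp
    then have "\<exists>b\<in>?T. card {y. - (y\<^sup>2 * f w3) = b} < 2"
      by (rule bexI[of _ 0]) (rule image_eqI[of _ _ 0], simp_all)
    ultimately have "(\<Sum>b\<in>?T. card {y. - (y\<^sup>2 * f w3) = b}) < (\<Sum>b\<in>?T. 2)"
      by (intro sum_strict_mono_ex1) auto
    moreover have "?q = (\<Sum>b\<in>?T. card {y \<in> UNIV. - (y\<^sup>2 * f w3) = b})"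
      using sum.group[of UNIV ?T "\<lambda>y. - (y\<^sup>2 * f w3)" "\<lambda>_. 1::nat"] by simp
    ultimately have cT: "?q < 2 * card ?T" by simp
    have "?S \<inter> ?T \<noteq> {}"
    proof
      assume "?S \<inter> ?T = {}"
      then have "card ?S + card ?T = card (?S \<union> ?T)" by (simp add: card_Un_disjoint)
      also have "\<dots> \<le> ?q" by (intro card_mono) auto
      finally show False using cS cT by linarith
    qed
    then obtain x y where xy: "f (w2 + x *s w1) = - (y\<^sup>2 * f w3)" by auto
    define v where "v = (w2 + x *s w1) + y *s w3"
    have "f v = 0" using xy w3 by (simp add: v_def f_add_scale B_simps)
    moreover have "v \<in> tangent_space" using w1 w2 w3 by (simp add: v_def tangent_space_def B_simps)
    ultimately obtain d where d: "v = d *s u" using aniso by (auto simp: multiples_def)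
    \<comment> \<open>Pairing with \<open>w3\<close> isolates \<open>y\<close>, since 2 is
      invertible. With \<open>y = 0\<close>, the vector \<open>w2\<close> would lie in the span of
      \<open>u\<close> and \<open>w1\<close>.\<close>
    have "B w3 v = y * (2 * f w3)" using w3 B_sym[of w3 w1] B_sym[of w3 w2] B_sym[of w3 u] by (simp add: v_def B_simps B_self)
    moreover have "B w3 v = 0" using w3 B_sym[of w3 w1] B_sym[of w3 w2] B_sym[of w3 u] by (simp add: d B_simps tangent_space_def)
    ultimately have "y = 0" using two f3 by simp
    then have "w2 = d *s u + (- x) *s w1" unfolding d[symmetric] by (simp add: v_def vec.scale_minus_left)
    then have "w2 \<in> G" unfolding G_def by (intro image_eqI[of _ _ "(d, - x)"]) auto
    then show False using w2(2) by simp
  qed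
qed

end

section \<open>Quadrics and the hermitian form\<close>

locale hermitian_quadric = hermitian_field t field_type + quadratic_map f B
  for t :: nat and field_type :: "'a::{field,finite} itself" and f :: "'a ^ 5 \<Rightarrow> 'a" and B +
  assumes t_ge_4: "t \<ge> 4"
begin

text \<open>Otherwise only t of the t^2 vectors \<open>y + c *s x\<close> would be
  isotropic.\<close>

lemma h_eq_0_if_totally_isotropic:
  assumes D: "vec.subspace D" and iso: "\<And>x. x \<in> D \<Longrightarrow> h x x = 0" and xy: "x \<in> D" "y \<in> D"
  shows "h x y = (0::'a)"
proof (rule ccontr)
  assume "h x y \<noteq> 0"
  then have "card {c. h (y + c *s x) (y + c *s x) = 0} = t"
    using iso xy by (intro card_roots_isotropic) auto
  moreover have "{c. h (y + c *s x) (y + c *s x) = 0} = UNIV"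
    using iso xy D by (auto simp: vec.subspace_def)
  ultimately show False using t_gt_1 by (simp add: card_field power2_eq_square)
qed

text \<open>Orthogonal pairs between \<open>D\<close> and the whole space are counted twice: through
  the hyperplanes \<open>perp d\<close>, and through the functionals \<open>h d x\<close> on
  \<open>D\<close>, which vanish on all of \<open>D\<close> for \<open>x\<close> in \<open>D\<close>
  and on at least one q-th of it otherwise. The outcome is that the square of \<open>card D\<close>
  is at most q^5.\<close>

lemma card_totally_isotropic_le:
  fixes D :: "('a ^ 5) set"
  assumes D: "vec.subspace D" and iso: "\<And>x. x \<in> D \<Longrightarrow> h x x = 0"
  shows "card D \<le> t ^ 5"
proof -
  let ?q = "CARD('a)" and ?V = "UNIV :: ('a ^ 5) set"
  have cV: "card ?V = t ^ 10" by (simp add: card_field flip: power_mult)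
  have D0: "0 \<in> D" using D by (rule vec.subspace_0)
  have "(\<Sum>x\<in>?V. card {d \<in> D. h d x = 0}) = (\<Sum>x\<in>?V. \<Sum>d\<in>D. of_bool (h d x = 0))"
    by (simp add: of_bool_def flip: sum.inter_filter)
  also have "\<dots> = (\<Sum>d\<in>D. \<Sum>x\<in>?V. of_bool (h d x = 0))" by (rule sum.swap)
  also have "\<dots> = (\<Sum>d\<in>D. card (perp d))"
    by (simp add: of_bool_def h_eq_0_sym flip: sum.inter_filter)
  also have "\<dots> = t ^ 10 + (card D - 1) * t ^ 8"
    using D0 cV by (subst sum.remove[of _ 0]) (auto simp: card_perp)
  finally have S: "(\<Sum>x\<in>?V. card {d \<in> D. h d x = 0}) = t ^ 10 + (card D - 1) * t ^ 8" .
  have "card D * (if x \<in> D then t\<^sup>2 else 1) \<le> t\<^sup>2 * card {d \<in> D. h d x = 0}" for x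
  proof (cases "x \<in> D")
    case True
    then have "{d \<in> D. h d x = 0} = D" using h_eq_0_if_totally_isotropic[OF D iso] by auto
    then show ?thesis using True by simp
  next
    case False
    then show ?thesis using card_kernel_ge[OF D linear_h[of x]] by (simp add: card_field)
  qed
  then have "(\<Sum>x\<in>?V. card D * (if x \<in> D then t\<^sup>2 else 1)) \<le> t\<^sup>2 * (t ^ 10 + (card D - 1) * t ^ 8)"
    unfolding S[symmetric] sum_distrib_left by (rule sum_mono)
  moreover have "(\<Sum>x\<in>?V. card D * (if x \<in> D then t\<^sup>2 else 1)) = card D * (card D * t\<^sup>2 + (t ^ 10 - card D))"
    by (subst sum_distrib_left[symmetric], subst sum_if_const) (use cV in auto)
  moreover have "card D \<le> t ^ 10" unfolding cV[symmetric] by (intro card_mono) auto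
  moreover have "card D > 0" using D0 by (auto simp: card_gt_0_iff)
  then have "card D \<ge> 1" by simp
  ultimately have le: "card D \<le> t ^ 10" "card D \<ge> 1"
    and "card D * (card D * t\<^sup>2 + (t ^ 10 - card D)) \<le> t\<^sup>2 * (t ^ 10 + (card D - 1) * t ^ 8)"
    by simp_all
  then have "int (card D * (card D * t\<^sup>2 + (t ^ 10 - card D))) \<le> int (t\<^sup>2 * (t ^ 10 + (card D - 1) * t ^ 8))"
    by (simp only: of_nat_le_iff)
  then have "int (card D) * (int (card D) * int t ^ 2 + (int t ^ 10 - int (card D)))
      \<le> int t ^ 2 * (int t ^ 10 + (int (card D) - 1) * int t ^ 8)"
    by (simp only: of_nat_mult of_nat_add of_nat_power of_nat_1 of_nat_diff[OF le(1)] of_nat_diff[OF le(2)])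
  \<comment> \<open>The difference of the two sides factors, and the first factor is positive, so
    the sign of the second one is known.\<close>
  moreover have "int t ^ 2 * (int t ^ 10 + (int (card D) - 1) * int t ^ 8)
      - int (card D) * (int (card D) * int t ^ 2 + (int t ^ 10 - int (card D)))
      = (int t ^ 2 - 1) * (int t ^ 10 - int (card D) ^ 2)"
    by algebra
  ultimately have "0 \<le> (int t ^ 2 - 1) * (int t ^ 10 - int (card D) ^ 2)" by linarith
  moreover have "int t ^ 2 - 1 > 0" using t_gt_1 by simp
  ultimately have "int (card D) ^ 2 \<le> int t ^ 10" by (simp add: zero_le_mult_iff)
  then have "int (card D) ^ 2 \<le> (int t ^ 5) ^ 2" by (simp flip: power_mult)
  then have "int (card D) \<le> int t ^ 5" by (rule power2_le_imp_le) simp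
  then show ?thesis by (metis of_nat_le_iff of_nat_power)
qed

text \<open>Along the conic, \<open>h\<close> is a polynomial in \<open>s\<close> of degree at most
  2t + 2 < q with q roots, hence zero. Its exponents are i + t j with i and j at most 2; these are
  distinct, and \<open>h c1 c1\<close> stands alone at t + 1.\<close>

lemma isotropic_direction_if_conic_isotropic:
  assumes "\<And>s. h (c0 + s *s c1 + s\<^sup>2 *s c2) (c0 + s *s c1 + s\<^sup>2 *s c2) = (0::'a)"
  shows "h c1 c1 = 0"
proof -
  define P where "P = monom (h c0 c0) 0 + monom (h c1 c0) 1 + monom (h c2 c0) 2 +
    monom (h c0 c1) t + monom (h c1 c1) (t + 1) + monom (h c2 c1) (t + 2) +
    monom (h c0 c2) (t + t) + monom (h c1 c2) (t + t + 1) + monom (h c2 c2) (t + t + 2)"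
  have ev: "poly P s = h (c0 + s *s c1 + s\<^sup>2 *s c2) (c0 + s *s c1 + s\<^sup>2 *s c2)" for s
    by (simp add: P_def poly_monom h_simps power_add algebra_simps power2_eq_square power_mult_distrib)
  have "P = 0"
  proof (rule ccontr)
    assume P: "P \<noteq> 0"
    have "degree P \<le> 2 * t + 2"
      unfolding P_def by (intro degree_add_le order_trans[OF degree_monom_le]) (use t_ge_4 in auto)
    then have "CARD('a) \<le> 2 * t + 2"
      using card_poly_eq_bound[OF P, of "2 * t + 2" "\<lambda>_. True"] assms by (simp add: ev)
    moreover have "4 * t \<le> t * t" using t_ge_4 by simp
    ultimately show False using t_ge_4 by (simp add: card_field power2_eq_square)
  qed
  then have "coeff P (t + 1) = 0" by simp
  then show ?thesis using t_ge_4 by (simp add: P_def)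
qed

abbreviation isotropic_zeros :: nat where
  "isotropic_zeros \<equiv> card {x. f x = 0 \<and> h x x = 0}"

text \<open>The zeros form a subspace that a line in the direction \<open>w\<close> meets at most
  once, so they number at most q^4. If the subspace contains a nonisotropic \<open>p\<close>, the
  lines in its direction have at most t + 1 isotropic vectors each; otherwise it is totally
  isotropic and even smaller.\<close>

lemma isotropic_zeros_singular_le:
  assumes sing: "\<And>x y. f x = 0 \<Longrightarrow> B x y = 0" and w: "f w \<noteq> 0"
  shows "isotropic_zeros \<le> (t + 1) * t ^ 6"
proof -
  let ?Z = "{x. f x = 0}"
  have Z: "vec.subspace ?Z"
    using sing by (auto simp: vec.subspace_def f_add f_scale)
  have "CARD('a) * card {x \<in> UNIV. f x = 0} \<le> 1 * card (UNIV :: ('a ^ 5) set)"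
  proof (rule card_average_le[where \<tau> = "\<lambda>c x. x + c *s w"])
    fix x
    have "c = d" if "f (x + c *s w) = 0" "f (x + d *s w) = 0" for c d
    proof -
      have "(x + c *s w) - (x + d *s w) = (c - d) *s w" by (simp add: vec.scale_left_diff_distrib)
      then have "f ((c - d) *s w) = 0" using vec.subspace_diff[OF Z, of "x + c *s w" "x + d *s w"] that by simp
      then have "(c - d)\<^sup>2 * f w = 0" by (simp only: f_scale)
      then show ?thesis using w by simp
    qed
    then show "card {c. f (x + c *s w) = 0} \<le> 1"
      by (intro card_le_Suc0_iff_eq[THEN iffD2, folded One_nat_def]) auto
  qed (auto simp: inj_on_def)
  then have "t ^ 2 * card ?Z \<le> t ^ 2 * t ^ 8" by (simp add: card_field flip: power_mult power_add)
  then have cZ: "card ?Z \<le> t ^ 8" by (rule mult_left_le_imp_le) simp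
  show ?thesis
  proof (cases "\<exists>p\<in>?Z. h p p \<noteq> 0")
    case True
    then obtain p where p: "p \<in> ?Z" "h p p \<noteq> 0" by blast
    have "CARD('a) * card {x \<in> ?Z. h x x = 0} \<le> (t + 1) * card ?Z"
    proof (rule card_average_le[where \<tau> = "\<lambda>c x. x + c *s p"])
      show "card {c. h (x + c *s p) (x + c *s p) = 0} \<le> t + 1" for x
        by (rule card_roots_nonisotropic_le[OF p(2)])
    qed (use p sing in \<open>auto simp: inj_on_def f_add_scale\<close>)
    also have "\<dots> \<le> (t + 1) * t ^ 8" using cZ by (rule mult_left_mono) simp
    also have "\<dots> = t ^ 2 * ((t + 1) * t ^ 6)" by (simp add: algebra_simps eval_nat_numeral)
    finally have "t ^ 2 * isotropic_zeros \<le> t ^ 2 * ((t + 1) * t ^ 6)"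
      by (simp add: card_field)
    then show ?thesis by simp
  next
    case False
    then have "card ?Z \<le> t ^ 5" using card_totally_isotropic_le[OF Z] by auto
    moreover have "isotropic_zeros \<le> card ?Z" by (intro card_mono) auto
    moreover have "t ^ 5 \<le> t ^ 6" using t_gt_1 by (intro power_increasing) auto
    moreover have "t ^ 6 \<le> (t + 1) * t ^ 6" by simp
    ultimately show ?thesis by linarith
  qed
qed

lemma ex_nonsingular_nonisotropic_zero:
  assumes "f u = 0" "B u v \<noteq> 0"
  shows "\<exists>u p. f u = 0 \<and> f p = 0 \<and> B u p = 1 \<and> h u u \<noteq> 0"
proof -
  \<comment> \<open>A vector not orthogonal to \<open>u\<close> becomes a zero of \<open>f\<close>
    after scaling and subtracting a multiple of \<open>u\<close>.\<close>
  have complete: "\<exists>p. f p = 0 \<and> B u p = 1" if "f u = 0" "B u v \<noteq> 0" for u v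
  proof -
    define w where "w = (1 / B u v) *s v"
    have w: "B u w = 1" using that by (simp add: w_def B_simps)
    have "B u u = 0" using that by (simp add: B_self)
    then have "f (w - f w *s u) = 0 \<and> B u (w - f w *s u) = 1"
      using w that B_sym[of w u] by (simp add: f_diff_scale B_simps)
    then show ?thesis by blast
  qed
  obtain p where p: "f p = 0" "B u p = 1" using complete[OF assms] by blast
  \<comment> \<open>The complement of the hyperbolic pair \<open>u\<close>, \<open>p\<close>. It has
    at least q^3 = t^6 elements, too many to be totally isotropic.\<close>
  define D where "D = {w \<in> {w \<in> UNIV. B u w = 0}. B p w = 0}"
  have D: "vec.subspace D" unfolding D_def by (intro subspace_kernel vec.subspace_UNIV linear_B_right)
  have "card (UNIV :: ('a ^ 5) set) \<le> CARD('a) * card {w \<in> UNIV. B u w = 0}"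
    by (intro card_kernel_ge vec.subspace_UNIV linear_B_right)
  also have "\<dots> \<le> CARD('a) * (CARD('a) * card D)"
    unfolding D_def by (intro mult_left_mono card_kernel_ge subspace_kernel vec.subspace_UNIV linear_B_right) simp
  finally have "t ^ 4 * t ^ 6 \<le> t ^ 4 * card D"
    by (simp add: card_field flip: power_mult power_add mult.assoc)
  then have "t ^ 6 \<le> card D" by (rule mult_left_le_imp_le) simp
  moreover have "t ^ 5 < t ^ 6" using t_gt_1 by (intro power_strict_increasing) auto
  ultimately have "\<not> card D \<le> t ^ 5" by simp
  then obtain w where w: "w \<in> D" "h w w \<noteq> 0" using card_totally_isotropic_le[OF D] by blast
  \<comment> \<open>The conic is the orbit of \<open>p\<close> under
    \<open>siegel u (s *s w)\<close>, so it consists of zeros of \<open>f\<close>. Its linear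
    coefficient is the nonisotropic \<open>w\<close>, hence not all of its vectors are isotropic;
    and each of them pairs to 1 with \<open>u\<close>, hence is nonsingular.\<close>
  then obtain s where s: "h (p + s *s w + s\<^sup>2 *s (- f w *s u)) (p + s *s w + s\<^sup>2 *s (- f w *s u)) \<noteq> 0"
    using isotropic_direction_if_conic_isotropic[of p w "- f w *s u"] by blast
  define u' where "u' = (p + s *s w) - (s\<^sup>2 * f w) *s u"
  have u'_eq: "p + s *s w + s\<^sup>2 *s (- f w *s u) = u'"
    by (simp add: u'_def vec.scale_minus_left)
  have "B u u = 0" using assms by (simp add: B_self)
  then have "f u' = 0" "B u' u = 1"
    using w(1) p assms B_sym[of p u] B_sym[of w u] B_sym[of p w]
    by (simp_all add: u'_def D_def f_diff_scale f_add_scale B_simps)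
  moreover have "h u' u' \<noteq> 0" using s unfolding u'_eq .
  ultimately show ?thesis using complete[of u' u] by auto
qed

end

section \<open>Estimate for a quadric with a nonsingular zero off the variety\<close>

locale hermitian_pointed_quadric =
  hermitian_quadric t field_type f B + finite_pointed_quadric f B u p\<^sub>0
  for t :: nat and field_type :: "'a::{field,finite} itself" and f :: "'a ^ 5 \<Rightarrow> 'a" and B u p\<^sub>0 +
  assumes huu: "h u u \<noteq> 0"
begin

text \<open>The point of intersection of the line spanned by \<open>u\<close> and \<open>z\<close> with the tangent space at \<open>p\<close>;
  the line joining it to \<open>p\<close> lies on the quadric.\<close>

definition direction :: "'a ^ 5 \<Rightarrow> 'a ^ 5 \<Rightarrow> 'a ^ 5" where
  "direction z p = z - B p z *s u"

text \<open>Exactly the points at which \<open>h\<close> is constant along the line in the given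
  direction: both the norm term and the trace term vanish. On every other line the isotropic vectors
  number at most t + 1.\<close>

definition bad :: "'a ^ 5 \<Rightarrow> ('a ^ 5) set" where
  "bad z = {p \<in> affine_part. h (direction z p) (direction z p) = 0 \<and> h p (direction z p) = 0}"

lemma siegel_scale: "siegel u (c *s w) p = p + c *s direction w p - (c\<^sup>2 * f w) *s u"
  by (simp add: siegel_def direction_def f_scale B_simps vec.scale_right_diff_distrib
      vec.scale_left_distrib algebra_simps)

text \<open>Bad points are charged with all q points of their line and the others with t + 1, an
  excess of t^2 - t - 1 for each bad point. The hypothesis on \<open>bad z\<close> is the bound that
  \<open>card_bad_le\<close> and \<open>card_bad_vertex_le\<close> supply.\<close>

lemma card_affine_isotropic_le:
  assumes z: "z \<in> tangent_space" "f z = 0" and b: "t\<^sup>2 * card (bad z) \<le> 3 * t ^ 6 - 2 * t ^ 4"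
  shows "int (card {p \<in> affine_part. h p p = 0}) \<le> (int t + 1) * int t ^ 4 + (int t ^ 2 - int t - 1) * (3 * int t ^ 2 - 2)"
proof -
  let ?A = "affine_part"
  have cA: "card ?A = t ^ 6" by (simp add: card_affine_part card_field flip: power_mult)
  have "CARD('a) * card {p \<in> ?A. h p p = 0} =
      (\<Sum>p\<in>?A. card {c. h (siegel u (c *s z) p) (siegel u (c *s z) p) = 0})"
    by (rule card_average) (use z in \<open>auto intro: inj_siegel siegel_affine_part scale_tangent_space\<close>)
  also have "\<dots> \<le> (\<Sum>p\<in>?A. if p \<in> bad z then t\<^sup>2 else t + 1)"
  proof (rule sum_mono)
    fix p assume p: "p \<in> ?A"
    let ?d = "direction z p"
    have eq: "siegel u (c *s z) p = p + c *s ?d" for c using z by (simp add: siegel_scale)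
    show "card {c. h (siegel u (c *s z) p) (siegel u (c *s z) p) = 0} \<le> (if p \<in> bad z then t\<^sup>2 else t + 1)"
    proof (cases "p \<in> bad z")
      case True
      then show ?thesis
        using card_mono[of UNIV "{c. h (siegel u (c *s z) p) (siegel u (c *s z) p) = 0}"]
        by (simp add: card_field)
    next
      case False
      then consider "h ?d ?d \<noteq> 0" | "h ?d ?d = 0" "h ?d p \<noteq> 0"
        using p h_eq_0_sym[of ?d p] by (auto simp: bad_def)
      then have "card {c. h (p + c *s ?d) (p + c *s ?d) = 0} \<le> t + 1"
        by cases (simp_all add: card_roots_nonisotropic_le card_roots_isotropic del: One_nat_def)
      then show ?thesis using False by (simp add: eq)
    qed
  qed
  also have "\<dots> = card (bad z) * t\<^sup>2 + (t ^ 6 - card (bad z)) * (t + 1)"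
    by (subst sum_if_const) (auto simp: cA bad_def intro!: arg_cong2[of _ _ _ _ "(+)"] arg_cong2[of _ _ _ _ "(*)"] arg_cong2[of _ _ _ _ "(-)"] arg_cong[of _ _ card])
  finally have 1: "t\<^sup>2 * card {p \<in> ?A. h p p = 0} \<le> card (bad z) * t\<^sup>2 + (t ^ 6 - card (bad z)) * (t + 1)"
    by (simp add: card_field)
  have 2: "card (bad z) \<le> t ^ 6" unfolding cA[symmetric] by (intro card_mono) (auto simp: bad_def)
  define S M where "S = int (card {p \<in> ?A. h p p = 0})" and "M = int (card (bad z))"
  from 1 have "int (t\<^sup>2 * card {p \<in> ?A. h p p = 0}) \<le> int (card (bad z) * t\<^sup>2 + (t ^ 6 - card (bad z)) * (t + 1))"
    by (simp only: of_nat_le_iff)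
  then have 1: "int t ^ 2 * S \<le> M * int t ^ 2 + (int t ^ 6 - M) * (int t + 1)"
    by (simp only: of_nat_mult of_nat_add of_nat_power of_nat_1 of_nat_diff[OF 2] S_def M_def)
  have "t ^ 4 \<le> t ^ 6" using t_gt_1 by (intro power_increasing) auto
  then have "t\<^sup>2 * card (bad z) + 2 * t ^ 4 \<le> 3 * t ^ 6" using b by linarith
  then have "int (t\<^sup>2 * card (bad z) + 2 * t ^ 4) \<le> int (3 * t ^ 6)" by (simp only: of_nat_le_iff)
  then have "int (t\<^sup>2 * card (bad z)) \<le> 3 * int t ^ 6 - 2 * int t ^ 4" by simp
  then have "int t ^ 2 * M \<le> int t ^ 2 * (3 * int t ^ 4 - 2 * int t ^ 2)"
    by (simp add: M_def algebra_simps flip: power_add)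
  then have M: "M \<le> 3 * int t ^ 4 - 2 * int t ^ 2" using mult_le_cancel_left_pos[of "int t ^ 2"] by simp
  have "4 * int t \<le> int t * int t" using t_ge_4 by (intro mult_right_mono) auto
  then have "0 \<le> int t ^ 2 - int t - 1" using t_ge_4 by (simp add: power2_eq_square)
  then have "(int t ^ 2 - int t - 1) * M \<le> (int t ^ 2 - int t - 1) * (3 * int t ^ 4 - 2 * int t ^ 2)"
    using M by (intro mult_left_mono)
  moreover have "M * int t ^ 2 + (int t ^ 6 - M) * (int t + 1) = (int t ^ 2 - int t - 1) * M + int t ^ 6 * (int t + 1)"
    by algebra
  moreover have "(int t ^ 2 - int t - 1) * (3 * int t ^ 4 - 2 * int t ^ 2) + int t ^ 6 * (int t + 1) =
      int t ^ 2 * ((int t + 1) * int t ^ 4 + (int t ^ 2 - int t - 1) * (3 * int t ^ 2 - 2))"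
    by algebra
  ultimately have "int t ^ 2 * S \<le> int t ^ 2 * ((int t + 1) * int t ^ 4 + (int t ^ 2 - int t - 1) * (3 * int t ^ 2 - 2))"
    using 1 by linarith
  then show ?thesis unfolding S_def using mult_le_cancel_left_pos[of "int t ^ 2"] by simp
qed

lemma card_affine_part_eq: "card affine_part = t ^ 6"
  by (simp add: card_affine_part card_field flip: power_mult)

text \<open>The moved point stands in the linear argument of \<open>h\<close>, so with
  \<open>d\<close> fixed the result is an ordinary quadratic in \<open>s\<close>, without powers
  \<open>s ^ t\<close>. Its leading coefficient is \<open>- f w * h u d\<close>.\<close>

lemma h_siegel_direction:
  "h (siegel u (s *s w) p) d = h p d - s\<^sup>2 * f w * h u d + s * (h w d - B p w * h u d)"
  by (simp add: siegel_scale direction_def h_simps algebra_simps)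

text \<open>Bad points whose direction is orthogonal to \<open>u\<close> have a prescribed value
  \<open>B p z\<close>. Moving by \<open>w2\<close> shifts that value linearly, which leaves t^4
  points. For the others, moving by \<open>w1\<close> fixes the direction and leads to a quadratic
  with nonzero leading coefficient, hence at most two bad points in q. Together, after
  multiplication by t^2, this is t^6 + 2 (t^6 - t^4).\<close>

lemma card_bad_le:
  assumes z: "z \<in> tangent_space" and w1: "w1 \<in> tangent_space" "B w1 z = 0" "f w1 \<noteq> 0"
    and w2: "w2 \<in> tangent_space" "B w2 z \<noteq> 0"
  shows "t\<^sup>2 * card (bad z) \<le> 3 * t ^ 6 - 2 * t ^ 4"
proof -
  let ?F = "{p \<in> affine_part. h u (direction z p) = 0}"
  let ?G = "{p \<in> affine_part. h u (direction z p) \<noteq> 0}"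
  let ?H = "{p \<in> ?G. h p (direction z p) = 0}"
  define b where "b = (h u z / h u u) ^ t"
  have "h u (direction z p) = 0 \<longleftrightarrow> B p z = b" for p
  proof -
    have "h u (direction z p) = h u z - B p z ^ t * h u u" by (simp add: direction_def h_simps)
    then have "h u (direction z p) = 0 \<longleftrightarrow> B p z ^ t = h u z / h u u" using huu by (auto simp: field_simps)
    also have "\<dots> \<longleftrightarrow> B p z = b" unfolding b_def by (metis frob_frob)
    finally show ?thesis .
  qed
  then have F: "?F = {p \<in> affine_part. B p z = b}" by auto
  have "CARD('a) * card {p \<in> affine_part. B p z = b} = 1 * card affine_part"
  proof (rule card_average_eq[where \<tau> = "\<lambda>s. siegel u (s *s w2)"])
    fix p
    have "{s. B (siegel u (s *s w2) p) z = b} = {(b - B p z) / B w2 z}"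
      using z w2 scale_tangent_space by (auto simp: B_siegel B_simps field_simps)
    then show "card {s. B (siegel u (s *s w2) p) z = b} = 1" by simp
  qed (use w2 in \<open>auto intro: inj_siegel siegel_affine_part scale_tangent_space\<close>)
  then have "t\<^sup>2 * card ?F = t\<^sup>2 * t ^ 4"
    unfolding F by (simp add: card_affine_part_eq card_field flip: power_add)
  then have cF: "card ?F = t ^ 4" by (subst (asm) mult_left_cancel) auto
  have "affine_part = ?F \<union> ?G" by auto
  then have "t ^ 6 = card ?F + card ?G"
    unfolding card_affine_part_eq[symmetric] by (subst card_Un_disjoint[symmetric]) auto
  then have cG: "card ?G = t ^ 6 - t ^ 4" using cF by simp
  have inv: "direction z (siegel u (s *s w1) p) = direction z p" for s p
    using z w1 scale_tangent_space[OF w1(1)] by (simp add: direction_def B_siegel B_simps)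
  have "CARD('a) * card ?H \<le> 2 * card ?G"
  proof (rule card_average_le[where \<tau> = "\<lambda>s. siegel u (s *s w1)"])
    fix p assume p: "p \<in> ?G"
    let ?d = "direction z p"
    have "card {s. h p ?d + s * (h w1 ?d - B p w1 * h u ?d) + s\<^sup>2 * (- f w1 * h u ?d) = 0} \<le> 2"
      by (rule card_quadratic_roots_le) (use p w1 in simp)
    then show "card {s. h (siegel u (s *s w1) p) (direction z (siegel u (s *s w1) p)) = 0} \<le> 2"
      unfolding inv h_siegel_direction by (simp add: algebra_simps)
  qed (use w1 inv in \<open>auto intro: inj_siegel siegel_affine_part scale_tangent_space\<close>)
  then have cH: "t\<^sup>2 * card ?H \<le> 2 * (t ^ 6 - t ^ 4)" by (simp add: card_field cG)
  have "card (bad z) \<le> card (?F \<union> ?H)" by (intro card_mono) (auto simp: bad_def)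
  also have "\<dots> \<le> card ?F + card ?H" by (rule card_Un_le)
  finally have "t\<^sup>2 * card (bad z) \<le> t\<^sup>2 * (card ?F + card ?H)" by (rule mult_left_mono) simp
  also have "\<dots> = t\<^sup>2 * t ^ 4 + t\<^sup>2 * card ?H" by (simp add: cF distrib_left)
  also have "t\<^sup>2 * t ^ 4 = t ^ 6" by (simp flip: power_add)
  finally have "t\<^sup>2 * card (bad z) \<le> t ^ 6 + 2 * (t ^ 6 - t ^ 4)" using cH by linarith
  moreover have "t ^ 4 \<le> t ^ 6" using t_gt_1 by (intro power_increasing) auto
  ultimately show ?thesis by linarith
qed

text \<open>Here \<open>z\<close> is a vertex of the quadric, so all points have the same direction
  \<open>z\<close> and bad points satisfy \<open>h p z = 0\<close>. Depending on where this
  functional is nonzero, translations give a quadratic condition (nonzero at \<open>u\<close>), a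
  linear one (nonzero at some tangent vector), or no solution, since \<open>z\<close> would
  otherwise be orthogonal to everything.\<close>

lemma card_bad_vertex_le:
  assumes z: "\<And>x. B x z = 0" "z \<noteq> 0" and w1: "w1 \<in> tangent_space" "f w1 \<noteq> 0"
  shows "t\<^sup>2 * card (bad z) \<le> 3 * t ^ 6 - 2 * t ^ 4"
proof -
  have d: "direction z p = z" for p by (simp add: direction_def z)
  let ?H = "{p \<in> affine_part. h p z = 0}"
  have "t\<^sup>2 * card ?H \<le> 2 * t ^ 6"
  proof (cases "h u z = 0")
    case False
    have "CARD('a) * card ?H \<le> 2 * card affine_part"
    proof (rule card_average_le[where \<tau> = "\<lambda>s. siegel u (s *s w1)"])
      fix p
      have "card {s. h p z + s * (h w1 z - B p w1 * h u z) + s\<^sup>2 * (- f w1 * h u z) = 0} \<le> 2"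
        by (rule card_quadratic_roots_le) (use False w1 in simp)
      then show "card {s. h (siegel u (s *s w1) p) z = 0} \<le> 2"
        unfolding h_siegel_direction by (simp add: algebra_simps)
    qed (use w1 in \<open>auto intro: inj_siegel siegel_affine_part scale_tangent_space\<close>)
    then show ?thesis by (simp add: card_field card_affine_part_eq)
  next
    case uz: True
    show ?thesis
    proof (cases "\<exists>w\<in>tangent_space. h w z \<noteq> 0")
      case True
      then obtain w where w: "w \<in> tangent_space" "h w z \<noteq> 0" by blast
      have "CARD('a) * card ?H = 1 * card affine_part"
      proof (rule card_average_eq[where \<tau> = "\<lambda>s. siegel u (s *s w)"])
        fix p
        have "{s. h (siegel u (s *s w) p) z = 0} = {- h p z / h w z}"
          using w uz by (auto simp: h_siegel_direction field_simps eq_neg_iff_add_eq_0 add.commute)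
        then show "card {s. h (siegel u (s *s w) p) z = 0} = 1" by simp
      qed (use w in \<open>auto intro: inj_siegel siegel_affine_part scale_tangent_space\<close>)
      then show ?thesis by (simp add: card_field card_affine_part_eq)
    next
      case False
      have "?H = {}"
      proof (rule ccontr)
        assume "?H \<noteq> {}"
        then obtain p where p: "B u p = 1" "h p z = 0" by (auto simp: affine_part_def)
        have "h x z = 0" for x
        proof -
          have "x - B u x *s p \<in> tangent_space" using p by (simp add: tangent_space_def B_simps)
          then have "h (x - B u x *s p) z = 0" using False by blast
          then show ?thesis using p by (simp add: h_simps)
        qed
        then show False using h_nondegenerate_right[OF z(2)] by blast
      qed
      then have "card ?H = 0" by (simp only: card.empty)
      then show ?thesis by (simp only: mult_0_right le0)
    qed
  qed
  moreover have "card (bad z) \<le> card ?H" by (intro card_mono) (auto simp: bad_def d)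
  then have "t\<^sup>2 * card (bad z) \<le> t\<^sup>2 * card ?H" by (rule mult_left_mono) simp
  moreover have "2 * t ^ 4 \<le> t ^ 6"
  proof -
    have "2 * t ^ 4 \<le> (t * t) * t ^ 4" using t_ge_4 mult_mono[of 2 t 1 t] by (intro mult_right_mono) auto
    then show ?thesis by (simp add: eval_nat_numeral mult.assoc)
  qed
  ultimately show ?thesis by linarith
qed

lemma ex_good_direction:
  assumes w: "w \<in> tangent_space" "f w \<noteq> 0"
  shows "\<exists>z\<in>tangent_space. f z = 0 \<and> t\<^sup>2 * card (bad z) \<le> 3 * t ^ 6 - 2 * t ^ 4"
proof -
  \<comment> \<open>A zero orthogonal to the tangent space becomes orthogonal to the whole space
    after subtracting a suitable multiple of \<open>u\<close>; it stays nonzero as it was no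
    multiple of \<open>u\<close>.\<close>
  have vertex: ?thesis
    if z: "z \<in> tangent_space" "f z = 0" "z \<notin> multiples" "\<And>x. x \<in> tangent_space \<Longrightarrow> B x z = 0" for z
  proof -
    define z' where "z' = z - B p\<^sub>0 z *s u"
    have "B p\<^sub>0 u = 1" using B_sym[of p\<^sub>0 u] by simp
    moreover have "B x u = 0" if "x \<in> tangent_space" for x
      using that B_sym[of x u] by (simp add: tangent_space_def)
    ultimately have zero: "B (y *s p\<^sub>0 + w) z' = 0" if "w \<in> tangent_space" for y w
      using that z(4) by (simp add: z'_def B_simps)
    have "B x z' = 0" for x using decomposition[of x] zero by metis
    moreover have "z' \<noteq> 0" using z(3) by (auto simp: z'_def multiples_def)
    moreover have "z' \<in> tangent_space" "f z' = 0"
      using z B_sym[of z u] by (simp_all add: z'_def tangent_space_def f_diff_scale B_simps)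
    ultimately show ?thesis using card_bad_vertex_le[of z' w] w by blast
  qed
  obtain z where z: "z \<in> tangent_space" "f z = 0" "z \<notin> multiples" using ex_tangent_zero by blast
  show ?thesis
  proof (cases "\<exists>w2\<in>tangent_space. B w2 z \<noteq> 0")
    case False
    then show ?thesis using vertex[OF z] by blast
  next
    case True
    then obtain w2 where w2: "w2 \<in> tangent_space" "B w2 z \<noteq> 0" by blast
    let ?N = "{x \<in> tangent_space. B z x = 0}"
    show ?thesis
    proof (cases "\<exists>w1\<in>?N. f w1 \<noteq> 0")
      case True
      then show ?thesis using card_bad_le[OF z(1) _ _ _ w2] z B_sym[of z] by auto
    next
      \<comment> \<open>Now \<open>f\<close>, and therefore \<open>B\<close>, vanishes on the
        hyperplane \<open>?N\<close> of the tangent space. A vector \<open>r\<close> of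
        \<open>?N\<close> that is also orthogonal to \<open>w2\<close> is orthogonal to the whole
        tangent space, and counting supplies one that is no multiple of \<open>u\<close>. So the
        vertex case applies to \<open>r\<close> in place of \<open>z\<close>.\<close>
      case N0: False
      have N: "vec.subspace ?N" by (intro subspace_kernel subspace_tangent_space linear_B_right)
      have "t ^ 8 \<le> t\<^sup>2 * card ?N"
        using card_kernel_ge[OF subspace_tangent_space linear_B_right[of z]]
        by (simp add: card_tangent_space card_field flip: power_mult)
      also have "\<dots> \<le> t\<^sup>2 * (t\<^sup>2 * card {x \<in> ?N. B w2 x = 0})"
        using card_kernel_ge[OF N linear_B_right[of w2]] by (intro mult_left_mono) (auto simp: card_field)
      finally have "t ^ 4 * t ^ 4 \<le> t ^ 4 * card {x \<in> ?N. B w2 x = 0}"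
        by (simp flip: power_add mult.assoc)
      then have "t ^ 4 \<le> card {x \<in> ?N. B w2 x = 0}" by (rule mult_left_le_imp_le) simp
      moreover have "t\<^sup>2 < t ^ 4" using t_gt_1 by (intro power_strict_increasing) auto
      ultimately obtain r where r: "r \<in> ?N" "B w2 r = 0" "r \<notin> multiples"
        using ex_not_multiple[of "{x \<in> ?N. B w2 x = 0}"] by (auto simp: card_field)
      have "B x r = 0" if x: "x \<in> tangent_space" for x
      proof -
        define y where "y = x - (B z x / B z w2) *s w2"
        have "B z w2 \<noteq> 0" using w2 B_sym[of z w2] by simp
        then have y: "y \<in> ?N" using x w2 by (simp add: y_def tangent_space_def B_simps)
        then have "y + r \<in> ?N" using r N by (auto simp: vec.subspace_def)
        then have "B y r = 0" using N0 y r f_add[of y r] by auto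
        then show ?thesis using r by (simp add: y_def B_simps)
      qed
      then show ?thesis using vertex[of r] r N0 by blast
    qed
  qed
qed

text \<open>The margin is the polynomial x^7 - 4x^6 - x^5 + 9x^4 - 4x^3 - 8x^2 + 2x + 2.
  Substituting x = y + 4 makes all its coefficients positive; the constant 906 is its value at x =
  4.\<close>

lemma zero_count_arithmetic:
  fixes x S :: int
  assumes "x \<ge> 4" and "S \<le> (x + 1) * x ^ 4 + (x ^ 2 - x - 1) * (3 * x ^ 2 - 2)"
  shows "2 * (x + 1) * x ^ 4 + (x ^ 2 - 1) * S < 2 * x ^ 7 - 3 * x ^ 5 + 2 * x ^ 4 + x ^ 3 - x ^ 2"
proof -
  define y where "y = x - 4"
  have y: "y \<ge> 0" "x = y + 4" using assms(1) by (simp_all add: y_def)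
  have "x ^ 2 - 1 \<ge> 0" using assms(1) by simp
  then have "(x ^ 2 - 1) * S \<le> (x ^ 2 - 1) * ((x + 1) * x ^ 4 + (x ^ 2 - x - 1) * (3 * x ^ 2 - 2))"
    using assms(2) by (rule mult_left_mono[rotated])
  moreover have "2 * x ^ 7 - 3 * x ^ 5 + 2 * x ^ 4 + x ^ 3 - x ^ 2
      - (2 * (x + 1) * x ^ 4 + (x ^ 2 - 1) * ((x + 1) * x ^ 4 + (x ^ 2 - x - 1) * (3 * x ^ 2 - 2)))
      = (906 + 4866 * y ^ 1 + 6312 * y ^ 2 + 3820 * y ^ 3 + 1269 * y ^ 4 + 239 * y ^ 5 + 24 * y ^ 6 + 1 * y ^ 7)"
    unfolding y(2) by algebra
  moreover have "0 < (906 + 4866 * y ^ 1 + 6312 * y ^ 2 + 3820 * y ^ 3 + 1269 * y ^ 4 + 239 * y ^ 5 + 24 * y ^ 6 + 1 * y ^ 7)" using y(1)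
    by (intro add_pos_nonneg mult_nonneg_nonneg zero_le_power) simp_all
  ultimately show ?thesis by linarith
qed

lemma isotropic_zeros_less:
  assumes w: "w \<in> tangent_space" "f w \<noteq> 0"
  shows "int isotropic_zeros < 2 * int t ^ 7 - 3 * int t ^ 5 + 2 * int t ^ 4 + int t ^ 3 - int t ^ 2"
proof -
  let ?S = "card {p \<in> affine_part. h p p = 0}" and ?C = "{x \<in> tangent_space. f x = 0}"
  obtain z where z: "z \<in> tangent_space" "f z = 0" "t\<^sup>2 * card (bad z) \<le> 3 * t ^ 6 - 2 * t ^ 4"
    using ex_good_direction[OF w] by blast
  \<comment> \<open>Adding multiples of \<open>u\<close> preserves the zeros in the tangent space,
    because \<open>B u\<close> vanishes there. As \<open>u\<close> is nonisotropic, each such line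
    has at most t + 1 isotropic vectors.\<close>
  have "CARD('a) * card {x \<in> ?C. h x x = 0} \<le> (t + 1) * card ?C"
  proof (rule card_average_le[where \<tau> = "\<lambda>c x. x + c *s u"])
    show "card {c. h (x + c *s u) (x + c *s u) = 0} \<le> t + 1" for x
      by (rule card_roots_nonisotropic_le[OF huu])
    show "x + c *s u \<in> ?C" if "x \<in> ?C" for c x
      using that B_sym[of x u] by (simp add: tangent_space_def f_add_scale B_simps)
  qed (auto simp: inj_on_def)
  also have "\<dots> \<le> (t + 1) * (2 * t ^ 6)"
    using card_tangent_zeros_le[OF w] by (intro mult_left_mono) (simp_all add: card_field flip: power_mult)
  also have "\<dots> = t\<^sup>2 * (2 * (t + 1) * t ^ 4)" by (simp add: algebra_simps eval_nat_numeral)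
  finally have "t\<^sup>2 * card {x \<in> ?C. h x x = 0} \<le> t\<^sup>2 * (2 * (t + 1) * t ^ 4)"
    by (simp only: card_field)
  then have "card {x \<in> ?C. h x x = 0} \<le> 2 * (t + 1) * t ^ 4" by (rule mult_left_le_imp_le) simp
  also have "{x \<in> ?C. h x x = 0} = {x \<in> tangent_space. f x = 0 \<and> h x x = 0}" by auto
  finally have "card {x \<in> tangent_space. f x = 0 \<and> h x x = 0} \<le> 2 * (t + 1) * t ^ 4" .
  moreover have "isotropic_zeros = card {x \<in> tangent_space. f x = 0 \<and> h x x = 0} + (t\<^sup>2 - 1) * ?S"
    unfolding card_field[symmetric] by (rule card_scaled_affine_part) (simp add: h_self_scale)
  ultimately have "isotropic_zeros \<le> 2 * (t + 1) * t ^ 4 + (t\<^sup>2 - 1) * ?S" by linarith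
  moreover have int_q: "int (t\<^sup>2 - 1) = int t ^ 2 - 1" using t_gt_1 by (simp add: of_nat_diff)
  ultimately have "int isotropic_zeros \<le> int (2 * (t + 1) * t ^ 4 + (t\<^sup>2 - 1) * ?S)" by (simp only: of_nat_le_iff)
  also have "\<dots> = 2 * (int t + 1) * int t ^ 4 + (int t ^ 2 - 1) * int ?S"
    using int_q by (simp only: of_nat_add of_nat_mult of_nat_power of_nat_1 of_nat_numeral)
  also have "\<dots> < 2 * int t ^ 7 - 3 * int t ^ 5 + 2 * int t ^ 4 + int t ^ 3 - int t ^ 2"
    by (rule zero_count_arithmetic[OF _ card_affine_isotropic_le[OF z]]) (use t_ge_4 in simp)
  finally show ?thesis .
qed

end

context hermitian_quadric
begin

theorem isotropic_zeros_less_or_product: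
  assumes "f w \<noteq> 0"
  shows "int isotropic_zeros < 2 * int t ^ 7 - 3 * int t ^ 5 + 2 * int t ^ 4 + int t ^ 3 - int t ^ 2 \<or>
    (\<exists>u p. f u = 0 \<and> f p = 0 \<and> B u p = 1 \<and> (\<forall>x. f x = B u x * B p x))"
proof (cases "\<exists>u v. f u = 0 \<and> B u v \<noteq> 0")
  case True
  then obtain u p where up: "f u = 0" "f p = 0" "B u p = 1" "h u u \<noteq> 0"
    using ex_nonsingular_nonisotropic_zero by blast
  then interpret hermitian_pointed_quadric t field_type f B u p
    by unfold_locales
  show ?thesis
  proof (cases "\<exists>w\<in>tangent_space. f w \<noteq> 0")
    case True
    then show ?thesis using isotropic_zeros_less by blast
  next
    case False
    then show ?thesis using up product_if_zero_on_tangent_space by blast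
  qed
next
  case False
  then have "isotropic_zeros \<le> (t + 1) * t ^ 6" using isotropic_zeros_singular_le assms by blast
  then have "int isotropic_zeros \<le> int ((t + 1) * t ^ 6)" by (simp only: of_nat_le_iff)
  also have "\<dots> = int t ^ 7 + int t ^ 6" by (simp add: algebra_simps eval_nat_numeral)
  also have "\<dots> < 2 * int t ^ 7 - 3 * int t ^ 5 + 2 * int t ^ 4 + int t ^ 3 - int t ^ 2"
  proof -
    define y where "y = int t - 4"
    have y: "y \<ge> 0" "int t = y + 4" using t_ge_4 by (simp_all add: y_def)
    have "2 * int t ^ 7 - 3 * int t ^ 5 + 2 * int t ^ 4 + int t ^ 3 - int t ^ 2 - (int t ^ 7 + int t ^ 6) = (9776 + 19240 * y ^ 1 + 15947 * y ^ 2 + 7233 * y ^ 3 + 1942 * y ^ 4 + 309 * y ^ 5 + 27 * y ^ 6 + 1 * y ^ 7)"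
      unfolding y(2) by algebra
    moreover have "0 < (9776 + 19240 * y ^ 1 + 15947 * y ^ 2 + 7233 * y ^ 3 + 1942 * y ^ 4 + 309 * y ^ 5 + 27 * y ^ 6 + 1 * y ^ 7)" using y(1)
    by (intro add_pos_nonneg mult_nonneg_nonneg zero_le_power) simp_all
    ultimately show ?thesis by linarith
  qed
  finally show ?thesis by blast
qed

end

section \<open>Quadratic forms and the code\<close>

lemma monomial_split:
  fixes g :: "'n::finite \<Rightarrow> nat"
  assumes "(\<Sum>i\<in>UNIV. g i) = Suc k"
  shows "\<exists>a g'. (\<Sum>i\<in>UNIV. g' i) = k \<and> (\<forall>x :: 'a::field ^ 'n. (\<Prod>i\<in>UNIV. x $ i ^ g i) = x $ a * (\<Prod>i\<in>UNIV. x $ i ^ g' i))"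
proof -
  obtain a where a: "g a \<noteq> 0" using assms by (metis finite_code nat.distinct(1) sum_eq_0_iff)
  define g' where "g' = g(a := g a - 1)"
  have "(\<Sum>i\<in>UNIV. g i) = g a + (\<Sum>i\<in>UNIV - {a}. g i)" by (simp add: sum.remove)
  moreover have "(\<Sum>i\<in>UNIV. g' i) = g' a + (\<Sum>i\<in>UNIV - {a}. g' i)" by (simp add: sum.remove)
  moreover have "(\<Sum>i\<in>UNIV - {a}. g' i) = (\<Sum>i\<in>UNIV - {a}. g i)" by (intro sum.cong) (auto simp: g'_def)
  ultimately have "(\<Sum>i\<in>UNIV. g' i) = k" using assms a by (simp add: g'_def)
  moreover have "(\<Prod>i\<in>UNIV. x $ i ^ g i) = x $ a * (\<Prod>i\<in>UNIV. x $ i ^ g' i)" for x :: "'a ^ 'n"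
  proof -
    have "(\<Prod>i\<in>UNIV. x $ i ^ g i) = x $ a ^ g a * (\<Prod>i\<in>UNIV - {a}. x $ i ^ g i)" by (simp add: prod.remove)
    moreover have "(\<Prod>i\<in>UNIV. x $ i ^ g' i) = x $ a ^ g' a * (\<Prod>i\<in>UNIV - {a}. x $ i ^ g' i)" by (simp add: prod.remove)
    moreover have "(\<Prod>i\<in>UNIV - {a}. x $ i ^ g' i) = (\<Prod>i\<in>UNIV - {a}. x $ i ^ g i)" by (intro prod.cong) (auto simp: g'_def)
    moreover have "x $ a ^ g a = x $ a * x $ a ^ g' a" using a by (simp add: g'_def flip: power_Suc)
    ultimately show ?thesis by simp
  qed
  ultimately show ?thesis by blast
qed

lemma quadratic_monomial:
  fixes g :: "'n::finite \<Rightarrow> nat"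
  assumes "(\<Sum>i\<in>UNIV. g i) = 2"
  shows "\<exists>a b. \<forall>x :: 'a::field ^ 'n. (\<Prod>i\<in>UNIV. x $ i ^ g i) = x $ a * x $ b"
proof -
  from assms have "(\<Sum>i\<in>UNIV. g i) = Suc 1" by simp
  then obtain a g' where g': "(\<Sum>i\<in>UNIV. g' i) = 1"
    "\<And>x :: 'a ^ 'n. (\<Prod>i\<in>UNIV. x $ i ^ g i) = x $ a * (\<Prod>i\<in>UNIV. x $ i ^ g' i)"
    using monomial_split[of g 1] by blast
  from g'(1) have "(\<Sum>i\<in>UNIV. g' i) = Suc 0" by simp
  then obtain b g'' where g'': "(\<Sum>i\<in>UNIV. g'' i) = 0"
    "\<And>x :: 'a ^ 'n. (\<Prod>i\<in>UNIV. x $ i ^ g' i) = x $ b * (\<Prod>i\<in>UNIV. x $ i ^ g'' i)"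
    using monomial_split[of g' 0] by blast
  then have "(\<Prod>i\<in>UNIV. x $ i ^ g'' i) = 1" for x :: "'a ^ 'n" by simp
  then have "\<forall>x :: 'a ^ 'n. (\<Prod>i\<in>UNIV. x $ i ^ g i) = x $ a * x $ b" using g'(2) g''(2) by simp
  then show ?thesis by blast
qed

lemma quadratic_map_product:
  "quadratic_map (\<lambda>x :: 'a::field ^ 'n. c * (x $ a * x $ b)) (\<lambda>x y. c * (x $ a * y $ b + y $ a * x $ b))"
  by unfold_locales (auto simp: linear_fun_def algebra_simps power2_eq_square)

lemma quadratic_map_sum:
  fixes F :: "'m \<Rightarrow> 'a::field ^ 'n \<Rightarrow> 'a"
  assumes "\<And>m. m \<in> S \<Longrightarrow> quadratic_map (F m) (G m)"
  shows "quadratic_map (\<lambda>x. \<Sum>m\<in>S. F m x) (\<lambda>x y. \<Sum>m\<in>S. G m x y)"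
proof
  show "(\<Sum>m\<in>S. F m 0) = 0" using quadratic_map.f_zero[OF assms] by (intro sum.neutral) blast
  show "(\<Sum>m\<in>S. F m (x + c *s y)) = (\<Sum>m\<in>S. F m x) + c * (\<Sum>m\<in>S. G m x y) + c\<^sup>2 * (\<Sum>m\<in>S. F m y)" for x c y
    using quadratic_map.f_add_scale[OF assms]
    by (simp add: sum_distrib_left flip: sum.distrib)
  show "linear_fun (\<lambda>x. \<Sum>m\<in>S. G m x y)" for y
    using quadratic_map.linear_B[OF assms]
    by (simp add: linear_fun_def sum_distrib_left flip: sum.distrib)
  show "(\<Sum>m\<in>S. G m x y) = (\<Sum>m\<in>S. G m y x)" for x y
    using quadratic_map.B_sym[OF assms] by (intro sum.cong) auto
qed

text \<open>The polar form is assembled monomial by monomial, from products of two coordinates, so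
  no division by 2 occurs.\<close>

lemma quadratic_map_eval_form:
  fixes f :: "('n::finite, 'a::field) mpol"
  assumes "f \<in> quadratic_forms"
  shows "\<exists>B. quadratic_map (eval_form f) B"
proof -
  have "\<forall>m\<in>Poly_Mapping.keys f. \<exists>G. quadratic_map
      (\<lambda>x :: 'a ^ 'n. Poly_Mapping.lookup f m * (\<Prod>i\<in>UNIV. x $ i ^ Poly_Mapping.lookup m i)) G"
  proof
    fix m assume "m \<in> Poly_Mapping.keys f"
    then have "(\<Sum>i\<in>UNIV. Poly_Mapping.lookup m i) = 2" using assms by (simp add: quadratic_forms_def)
    then obtain a b where "\<And>x :: 'a ^ 'n. (\<Prod>i\<in>UNIV. x $ i ^ Poly_Mapping.lookup m i) = x $ a * x $ b"
      using quadratic_monomial by blast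
    then show "\<exists>G. quadratic_map
      (\<lambda>x :: 'a ^ 'n. Poly_Mapping.lookup f m * (\<Prod>i\<in>UNIV. x $ i ^ Poly_Mapping.lookup m i)) G"
      by (simp only:) (rule exI, rule quadratic_map_product)
  qed
  from bchoice[OF this] obtain G where G: "\<forall>m\<in>Poly_Mapping.keys f. quadratic_map
      (\<lambda>x :: 'a ^ 'n. Poly_Mapping.lookup f m * (\<Prod>i\<in>UNIV. x $ i ^ Poly_Mapping.lookup m i)) (G m)" ..
  have "quadratic_map (eval_form f) (\<lambda>x y. \<Sum>m\<in>Poly_Mapping.keys f. G m x y)"
    unfolding eval_form_def[abs_def] by (rule quadratic_map_sum) (rule bspec[OF G])
  note * = this
  show ?thesis by (intro exI) (rule *)
qed

section \<open>Forms that are products of two linear forms\<close>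

lemma eval_form_superset:
  assumes "finite S" "Poly_Mapping.keys f \<subseteq> S"
  shows "eval_form f x = (\<Sum>m\<in>S. Poly_Mapping.lookup f m * (\<Prod>i\<in>UNIV. x $ i ^ Poly_Mapping.lookup m i))"
  unfolding eval_form_def using assms
  by (intro sum.mono_neutral_left) (auto simp: in_keys_iff)

lemma eval_form_zero: "eval_form 0 x = 0"
  by (simp add: eval_form_def)

lemma eval_form_add: "eval_form (f + g) x = eval_form f x + eval_form g x"
proof -
  let ?S = "Poly_Mapping.keys f \<union> Poly_Mapping.keys g"
  have "Poly_Mapping.keys (f + g) \<subseteq> ?S" by (rule Poly_Mapping.keys_add)
  then show ?thesis
    by (simp add: eval_form_superset[of ?S] lookup_add sum.distrib distrib_right)
qed

lemma eval_form_sum: "eval_form (\<Sum>i\<in>I. F i) x = (\<Sum>i\<in>I. eval_form (F i) x)"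
  by (induction I rule: infinite_finite_induct) (simp_all add: eval_form_zero eval_form_add)

lemma eval_form_single:
  "eval_form (Poly_Mapping.single m c) x = c * (\<Prod>i\<in>UNIV. x $ i ^ Poly_Mapping.lookup m i)"
  by (subst eval_form_superset[of "{m}"]) auto

lemma quadratic_forms_add: "f \<in> quadratic_forms \<Longrightarrow> g \<in> quadratic_forms \<Longrightarrow> f + g \<in> quadratic_forms"
  using Poly_Mapping.keys_add[of f g] by (auto simp: quadratic_forms_def)

lemma quadratic_forms_zero: "0 \<in> quadratic_forms"
  by (simp add: quadratic_forms_def)

lemma quadratic_forms_sum: "(\<And>i. i \<in> I \<Longrightarrow> F i \<in> quadratic_forms) \<Longrightarrow> (\<Sum>i\<in>I. F i) \<in> quadratic_forms"
  by (induction I rule: infinite_finite_induct) (simp_all add: quadratic_forms_zero quadratic_forms_add)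

text \<open>Needed to realise weights. The monomials \<open>e i j\<close> and \<open>e j i\<close>
  coincide; summing single terms lets their coefficients add up.\<close>

lemma ex_form_product:
  fixes a b :: "'a::field ^ 'n::finite"
  shows "\<exists>f\<in>quadratic_forms. \<forall>x. eval_form f x = (\<Sum>i\<in>UNIV. a $ i * x $ i) * (\<Sum>i\<in>UNIV. b $ i * x $ i)"
proof -
  define e where "e = (\<lambda>i j :: 'n. Poly_Mapping.single i (1::nat) + Poly_Mapping.single j 1)"
  define f where "f = (\<Sum>i\<in>UNIV. \<Sum>j\<in>UNIV. Poly_Mapping.single (e i j) (a $ i * b $ j))"
  have "(\<Sum>k\<in>UNIV. Poly_Mapping.lookup (e i j) k) = 2" for i j
    by (simp add: e_def lookup_add lookup_single sum.distrib when_def)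
  then have "Poly_Mapping.single (e i j) (a $ i * b $ j) \<in> quadratic_forms" for i j
    by (simp add: quadratic_forms_def)
  then have "f \<in> quadratic_forms" unfolding f_def by (intro quadratic_forms_sum)
  moreover have "(\<Prod>k\<in>UNIV. x $ k ^ Poly_Mapping.lookup (e i j) k) = x $ i * x $ j" for x :: "'a ^ 'n" and i j
  proof -
    have "x $ k ^ Poly_Mapping.lookup (e i j) k = (if k = i then x $ k else 1) * (if k = j then x $ k else 1)" for k
      by (auto simp: e_def lookup_add lookup_single when_def)
    then show ?thesis by (simp add: prod.distrib)
  qed
  then have "eval_form f x = (\<Sum>i\<in>UNIV. a $ i * x $ i) * (\<Sum>i\<in>UNIV. b $ i * x $ i)" for x
    by (simp add: f_def eval_form_sum eval_form_single sum_product mult_ac)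
  ultimately show ?thesis by blast
qed

section \<open>From vectors to projective points and poles\<close>

lemma proj_space_cover: "x \<noteq> 0 \<Longrightarrow> \<exists>Q\<in>proj_space. x \<in> (Q :: ('a::field ^ 'n) set)"
  using equiv_class_self[OF equiv_proj_rel, of x] by (auto simp: proj_space_def quotient_def)

lemma card_affine_cone:
  fixes P :: "'a::{field,finite} ^ 'n \<Rightarrow> bool"
  assumes P: "\<And>c x. c \<noteq> 0 \<Longrightarrow> P (c *s x) \<longleftrightarrow> P x"
  shows "card {x. x \<noteq> 0 \<and> P x} = (CARD('a) - 1) * card {Q \<in> proj_space. \<forall>x\<in>Q. P x}"
proof -
  let ?S = "{Q \<in> proj_space. \<forall>x\<in>Q. P x}"
  have "{x. x \<noteq> 0 \<and> P x} = \<Union>?S"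
  proof (intro equalityI subsetI)
    fix x assume x: "x \<in> {x. x \<noteq> 0 \<and> P x}"
    then obtain Q where Q: "Q \<in> proj_space" "x \<in> Q" using proj_space_cover by blast
    then have "\<forall>y\<in>Q. P y" using proj_space_rep(2)[OF Q] P x by auto
    then show "x \<in> \<Union>?S" using Q by blast
  next
    fix x assume "x \<in> \<Union>?S"
    then show "x \<in> {x. x \<noteq> 0 \<and> P x}" using proj_space_rep(1) by blast
  qed
  moreover have "card (\<Union>?S) = (\<Sum>Q\<in>?S. card Q)"
  proof (rule card_Union_disjoint)
    show "pairwise disjnt ?S"
      using quotient_disj[OF equiv_proj_rel] by (fastforce simp: pairwise_def disjnt_def proj_space_def)
  qed simp
  moreover have "card Q = CARD('a) - 1" if Q: "Q \<in> ?S" for Q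
  proof -
    obtain x where x: "x \<in> Q" using some_in_proj Q by blast
    have nz: "x \<noteq> 0" and "Q = (\<lambda>c. c *s x) ` (UNIV - {0})"
      using proj_space_rep[of Q x] Q x by auto
    moreover have "inj_on (\<lambda>c. c *s x) (UNIV - {0})"
      using nz by (auto simp: inj_on_def)
    ultimately show ?thesis by (simp add: card_image card_Diff_singleton)
  qed
  ultimately show ?thesis by simp
qed

context hermitian_field
begin

abbreviation variety :: "('a ^ 5) set set" where
  "variety \<equiv> hermitian_variety t"

text \<open>The coefficient vector of the hyperplane with pole \<open>p\<close>. Conjugation is an
  involution, so each coefficient vector has exactly one pole.\<close>

definition conj_vec :: "'a ^ 'n \<Rightarrow> 'a ^ 'n" where
  "conj_vec p = (\<chi> i. p $ i ^ t)"

lemma conj_conj [simp]: "conj_vec (conj_vec p) = p"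
  by (simp add: conj_vec_def vec_eq_iff)

lemma conj_eq_0 [simp]: "conj_vec p = 0 \<longleftrightarrow> p = 0"
  by (simp add: conj_vec_def vec_eq_iff)

lemma sum_conj: "(\<Sum>i\<in>UNIV. conj_vec p $ i * x $ i) = h x p"
  by (simp add: conj_vec_def hermitian_form_def mult.commute)

definition polar :: "'a ^ 'n \<Rightarrow> ('a ^ 'n) set set" where
  "polar p = {Q \<in> proj_space. \<forall>x\<in>Q. h x p = 0}"

lemma hyperplane_conj: "hyperplane (conj_vec p) = polar p"
  by (simp add: hyperplane_def polar_def sum_conj)

lemma is_hyperplane_polar: "p \<noteq> 0 \<Longrightarrow> is_hyperplane (polar p)"
  unfolding is_hyperplane_def using hyperplane_conj[of p] conj_eq_0 by blast

lemma h_zero_class: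
  assumes "Q \<in> proj_space" "x \<in> Q" "y \<in> Q"
  shows "h x p = 0 \<longleftrightarrow> h y p = 0"
  using proj_space_rep(2)[OF assms(1,2)] assms(3) by (auto simp: h_simps)

lemma in_polar_iff: "Q \<in> proj_space \<Longrightarrow> x \<in> Q \<Longrightarrow> Q \<in> polar p \<longleftrightarrow> h x p = 0"
  unfolding polar_def using h_zero_class by blast

lemma polar_eq_imp:
  assumes "polar p = polar r" "h x p = 0"
  shows "h x r = 0"
proof (cases "x = 0")
  case False
  then obtain Q where Q: "Q \<in> proj_space" "x \<in> Q" using proj_space_cover by blast
  then show ?thesis using assms in_polar_iff[OF Q] by metis
qed simp

lemma polar_neq: "indep r s \<Longrightarrow> polar r \<noteq> polar s"
  using indep_perp[of r s] polar_eq_imp[of r s] by auto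

lemma indep_if_polar_neq:
  assumes "polar r \<noteq> polar s" "r \<noteq> 0" "s \<noteq> 0"
  shows "indep r s"
proof -
  have "s \<noteq> c *s r" for c
  proof
    assume s: "s = c *s r"
    then have "c \<noteq> 0" using assms(3) by auto
    then have "polar s = polar r" by (simp add: s polar_def h_scale_right)
    then show False using assms(1) by simp
  qed
  then show ?thesis using assms(2) by (simp add: indep_def)
qed

lemma in_variety_iff: "Q \<in> variety \<longleftrightarrow> Q \<in> proj_space \<and> (\<forall>x\<in>Q. h x x = 0)"
  by (simp add: hermitian_variety_def hermitian_form_def)

text \<open>The tangent hyperplane at a point is its polar, and two poles of one hyperplane are
  proportional, so isotropy does not depend on the chosen pole.\<close>

lemma tangent_polar_iff:
  fixes r :: "'a ^ 5"
  assumes r: "r \<noteq> 0"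
  shows "tangent_to_hermitian t (polar r) \<longleftrightarrow> h r r = 0"
proof
  assume "tangent_to_hermitian t (polar r)"
  then obtain P p where p: "P \<in> variety" "p \<in> P" "polar r = hyperplane (conj_vec p)"
    by (auto simp: tangent_to_hermitian_def conj_vec_def)
  then have "h p p = 0" "p \<noteq> 0" using proj_space_rep(1) by (auto simp: in_variety_iff)
  moreover have "polar p = polar r" using p(3) by (simp add: hyperplane_conj)
  then obtain c where "r = c *s p"
    using perp_subset_imp_multiple[OF \<open>p \<noteq> 0\<close>, of r] polar_eq_imp by blast
  ultimately show "h r r = 0" by (simp add: h_self_scale)
next
  assume "h r r = 0"
  obtain Q where Q: "Q \<in> proj_space" "r \<in> Q" using proj_space_cover[OF r] by blast
  then have "Q \<in> variety"
    using proj_space_rep(2)[OF Q] \<open>h r r = 0\<close> by (auto simp: in_variety_iff h_self_scale)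
  then show "tangent_to_hermitian t (polar r)"
    unfolding tangent_to_hermitian_def using Q hyperplane_conj[of r] by (auto simp: conj_vec_def)
qed

lemma tangent_imp_polar:
  assumes "tangent_to_hermitian t (H :: ('a ^ 5) set set)"
  shows "\<exists>p. p \<noteq> 0 \<and> h p p = 0 \<and> H = polar p"
proof -
  obtain P p where p: "P \<in> variety" "p \<in> P" "H = hyperplane (conj_vec p)"
    using assms by (auto simp: tangent_to_hermitian_def conj_vec_def)
  then show ?thesis using proj_space_rep(1) by (auto simp: in_variety_iff hyperplane_conj)
qed

lemma cone_polar_inter: "cone (polar r \<inter> polar s) = perp2 r s"
proof (intro equalityI subsetI)
  fix x assume "x \<in> cone (polar r \<inter> polar s)"
  then show "x \<in> perp2 r s" by (auto simp: cone_def polar_def)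
next
  fix x assume x: "x \<in> perp2 r s"
  show "x \<in> cone (polar r \<inter> polar s)"
  proof (cases "x = 0")
    case False
    then obtain Q where Q: "Q \<in> proj_space" "x \<in> Q" using proj_space_cover by blast
    then have "Q \<in> polar r \<inter> polar s" using in_polar_iff[OF Q] x by simp
    then show ?thesis using Q by (auto simp: cone_def)
  qed (simp add: cone_def)
qed

end

section \<open>Gram matrices and nonsingular plane sections\<close>

lemma rank_eq_3_iff:
  fixes G :: "'a::field ^ 3 ^ 3"
  shows "rank G = 3 \<longleftrightarrow> (\<forall>x. G *v x = 0 \<longrightarrow> x = 0)"
proof -
  have "vec.dim (UNIV :: ('a ^ 3) set) = 3" by (simp only: vec_dim_card) simp
  then have "card (cart_basis :: ('a ^ 3) set) = 3" by simp
  then have "rank G = 3 \<longleftrightarrow> vec.span (rows G) = UNIV"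
    using vec.dim_eq_full[of "rows G"] by (simp add: row_rank_def_gen vec.dimension_def)
  also have "\<dots> \<longleftrightarrow> (\<forall>x. G *v x = 0 \<longrightarrow> x = 0)"
    unfolding matrix_left_invertible_span_rows_gen[symmetric] matrix_left_invertible_ker ..
  finally show ?thesis .
qed

context hermitian_field
begin

lemma h_sum_right: "h x (\<Sum>i\<in>I. c i *s v i) = (\<Sum>i\<in>I. c i ^ t * h x (v i))"
  by (induction I rule: infinite_finite_induct) (auto simp: h_simps)

text \<open>Column indices sit in the semilinear argument of \<open>h\<close>, so \<open>x\<close>
  acts through conjugated coordinates. Kernel vectors of the Gram matrix thus correspond to vectors
  of the span that are orthogonal to all rows, that is, to the radical.\<close>

lemma gram_kernel:
  "(hermitian_gram t V *v x) $ i = h (V $ i) (\<Sum>j\<in>UNIV. x $ j ^ t *s V $ j)"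
  by (simp add: matrix_vector_mult_def hermitian_gram_def h_sum_right mult.commute)

lemma perp2_complement:
  assumes "h r r = 0" "h s s = 0" "h r s \<noteq> 0"
  shows "\<exists>a b. v - a *s r - b *s s \<in> perp2 r s"
proof -
  have "h s r \<noteq> 0" using assms h_eq_0_sym by blast
  then have "v - (h v s / h r s) *s r - (h v r / h s r) *s s \<in> perp2 r s"
    using assms by (simp add: h_simps)
  then show ?thesis by blast
qed

text \<open>A hyperbolic pair \<open>r\<close>, \<open>s\<close> is a complement of
  \<open>perp2 r s\<close>, whence 5 - 2.\<close>

lemma dim_perp2:
  fixes r s :: "'a ^ 5"
  assumes rs: "h r r = 0" "h s s = 0" "h r s \<noteq> 0"
  shows "vec.dim (perp2 r s) = 3"
proof -
  let ?E = "perp2 r s"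
  have sr: "h s r \<noteq> 0" using rs h_eq_0_sym by blast
  have E: "vec.span ?E = ?E" using subspace_perp2 by (rule vec.span_eq_iff[THEN iffD2])
  have s: "s \<notin> vec.span ?E" unfolding E using sr by simp
  have r: "r \<notin> vec.span (insert s ?E)"
  proof
    assume "r \<in> vec.span (insert s ?E)"
    then obtain k where "r - k *s s \<in> ?E" unfolding vec.span_insert E by blast
    then show False using rs sr by (simp add: h_simps)
  qed
  have "v \<in> vec.span (insert r (insert s ?E))" for v
    using perp2_complement[OF rs, of v] unfolding vec.span_insert E by simp
  then have U: "vec.span (insert r (insert s ?E)) = UNIV" by blast
  have "vec.dim (UNIV :: ('a ^ 5) set) = 5" by (simp only: vec_dim_card) simp
  then have "vec.dim (insert r (insert s ?E)) = 5" unfolding U[symmetric] vec.dim_span .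
  then show ?thesis using r s by (simp add: vec.dim_insert)
qed

text \<open>The section is singular exactly when the plane has a nonzero vector orthogonal to all of
  it. If \<open>h r s = 0\<close>, such a vector is \<open>r\<close>, which then lies in the plane.
  If \<open>h r s \<noteq> 0\<close>, the plane and the two poles span the space, and nondegeneracy
  of \<open>h\<close> leaves only 0.\<close>

lemma nonsingular_plane_section_iff:
  fixes r s :: "'a ^ 5"
  assumes i: "indep r s" and iso: "h r r = 0" "h s s = 0"
  shows "nonsingular_plane_section t (polar r \<inter> polar s) \<longleftrightarrow> h r s \<noteq> 0"
proof
  assume "nonsingular_plane_section t (polar r \<inter> polar s)"
  then obtain V :: "'a ^ 5 ^ 3" where V: "inj (($) V)" "vec.span (rows V) = perp2 r s"
    "rank (hermitian_gram t V) = 3"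
    by (auto simp: nonsingular_plane_section_def cone_polar_inter)
  show "h r s \<noteq> 0"
  proof
    assume "h r s = 0"
    then have "r \<in> vec.span (rows V)" using V(2) iso by simp
    moreover have rows: "rows V = range (($) V)" by (auto simp: rows_def row_def)
    ultimately obtain c where "r = (\<Sum>v\<in>range (($) V). c v *s v)"
      by (auto simp: vec.span_finite)
    then have c: "r = (\<Sum>j\<in>UNIV. c (V $ j) *s V $ j)" using V(1) by (simp add: sum.reindex)
    \<comment> \<open>Conjugated coefficients, so that the combination in \<open>gram_kernel\<close>
      is \<open>r\<close> itself.\<close>
    define x where "x = (\<chi> j. c (V $ j) ^ t)"
    have sum: "(\<Sum>j\<in>UNIV. x $ j ^ t *s V $ j) = r" by (subst c) (simp add: x_def)
    have "V $ k \<in> perp2 r s" for k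
      unfolding V(2)[symmetric] rows by (rule vec.span_base) simp
    then have "(hermitian_gram t V *v x) $ k = 0" for k unfolding gram_kernel sum by simp
    then have "hermitian_gram t V *v x = 0" by (simp add: vec_eq_iff)
    then have "x = 0" using V(3) rank_eq_3_iff by blast
    then have "c (V $ j) = 0" for j by (simp add: x_def vec_eq_iff)
    then have "(\<Sum>j\<in>UNIV. c (V $ j) *s V $ j) = 0" by simp
    then have "r = 0" using c by (rule trans[rotated])
    then show False using i by (simp add: indep_def)
  qed
next
  assume rs: "h r s \<noteq> 0"
  let ?E = "perp2 r s"
  obtain S where S: "S \<subseteq> ?E" "vec.independent S" "?E \<subseteq> vec.span S" "card S = vec.dim ?E"
    by (rule vec.basis_exists)
  have span: "vec.span S = ?E"
    using S(1,3) vec.span_minimal[OF S(1) subspace_perp2] by blast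
  have "card (UNIV :: 3 set) = card S" unfolding S(4) dim_perp2[OF iso rs] by simp
  then obtain g :: "3 \<Rightarrow> 'a ^ 5" where g: "bij_betw g UNIV S"
    using finite_same_card_bij[of "UNIV :: 3 set" S] by auto
  define V :: "'a ^ 5 ^ 3" where "V = (\<chi> j. g j)"
  have Vg: "($) V = g" by (simp add: V_def fun_eq_iff)
  have rows: "rows V = S" using g by (auto simp: rows_def row_def Vg bij_betw_def)
  have inj: "inj (($) V)" using g by (simp add: Vg bij_betw_def)
  have "x = 0" if x: "hermitian_gram t V *v x = 0" for x
  proof -
    define y where "y = (\<Sum>j\<in>UNIV. x $ j ^ t *s V $ j)"
    have "V $ k \<in> S" for k using g by (auto simp: Vg bij_betw_def)
    then have y: "y \<in> ?E"
      unfolding y_def span[symmetric] by (intro vec.span_sum vec.span_scale vec.span_base)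
    have "h (V $ k) y = 0" for k using x unfolding y_def gram_kernel[symmetric] by simp
    then have "S \<subseteq> perp y" using g by (fastforce simp: Vg bij_betw_def)
    then have Ey: "h e y = 0" if "e \<in> ?E" for e
      using vec.span_minimal[OF _ subspace_perp, of S y] span that by blast
    \<comment> \<open>\<open>y\<close> is orthogonal to the plane through the basis
      \<open>S\<close>, and to \<open>r\<close> and \<open>s\<close> because it lies in the plane;
      together these span everything.\<close>
    have "h v y = 0" for v
    proof -
      obtain a b where "v - a *s r - b *s s \<in> ?E" using perp2_complement[OF iso rs] by blast
      then have "h (v - a *s r - b *s s) y = 0" by (rule Ey)
      moreover have "h r y = 0" "h s y = 0" using y h_eq_0_sym by auto
      ultimately show ?thesis by (simp add: h_simps)
    qed
    then have "y = 0" using h_nondegenerate_right by blast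
    have "(\<Sum>j\<in>UNIV. x $ j ^ t *s V $ j) = (\<Sum>v\<in>S. x $ inv_into UNIV g v ^ t *s v)"
      using g by (intro sum.reindex_bij_witness[of _ "inv_into UNIV g" g])
        (auto simp: Vg bij_betw_def inv_into_f_f f_inv_into_f)
    then have "(\<Sum>v\<in>S. x $ inv_into UNIV g v ^ t *s v) = 0" using \<open>y = 0\<close> y_def by simp
    then have "\<forall>v\<in>S. x $ inv_into UNIV g v ^ t = 0"
      using vec.independentD[OF S(2) finite subset_refl, of "\<lambda>v. x $ inv_into UNIV g v ^ t"] by simp
    then have "x $ j = 0" for j
      using g by (force simp: bij_betw_def inv_into_f_f)
    then show ?thesis by (simp add: vec_eq_iff)
  qed
  then show "nonsingular_plane_section t (polar r \<inter> polar s)"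
    unfolding nonsingular_plane_section_def cone_polar_inter rank_eq_3_iff
    using inj rows S(2) span by blast
qed

section \<open>Weights of codewords\<close>

lemma in_zero_set_iff:
  assumes f: "f \<in> quadratic_forms" and Q: "Q \<in> proj_space" "x \<in> Q"
  shows "Q \<in> zero_set f \<longleftrightarrow> eval_form f x = 0"
  using proj_space_rep(2)[OF Q] Q by (auto simp: zero_set_def eval_form_scale[OF f])

abbreviation weight :: "(5, 'a) mpol \<Rightarrow> nat" where
  "weight f \<equiv> hamming_weight variety (codeword variety f)"

text \<open>Each projective point accounts for q - 1 nonzero vectors. The zero vector belongs to
  both vector counts and cancels in their difference.\<close>

lemma weight_eq:
  assumes f: "f \<in> quadratic_forms"
  shows "(int t ^ 2 - 1) * int (weight f) =
    int t ^ 9 - int t ^ 5 + int t ^ 4 - int (card {x. eval_form f x = 0 \<and> h x x = 0})"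
proof -
  have f0: "eval_form f 0 = 0" using eval_form_scale[OF f, of 0 0] by simp
  have V: "{Q \<in> proj_space. \<forall>x\<in>Q. h x x = 0} = variety" by (auto simp: in_variety_iff)
  have 1: "card {x :: 'a ^ 5. x \<noteq> 0 \<and> h x x = 0} = (t\<^sup>2 - 1) * card variety"
    using card_affine_cone[of "\<lambda>x :: 'a ^ 5. h x x = 0"]
    by (simp add: h_self_scale card_field V)
  have "variety \<inter> zero_set f = {Q \<in> proj_space. \<forall>x\<in>Q. eval_form f x = 0 \<and> h x x = 0}"
    by (auto simp: in_variety_iff zero_set_def)
  then have 2: "card {x. x \<noteq> 0 \<and> eval_form f x = 0 \<and> h x x = 0} = (t\<^sup>2 - 1) * card (variety \<inter> zero_set f)"
    using card_affine_cone[of "\<lambda>x. eval_form f x = 0 \<and> h x x = 0"]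
    by (simp add: h_self_scale card_field eval_form_scale[OF f])
  have "{x \<in> UNIV. h x x = 0} = insert 0 {x :: 'a ^ 5. x \<noteq> 0 \<and> h x x = 0}" by auto
  then have 3: "isotropic_count (UNIV :: ('a ^ 5) set) = Suc ((t\<^sup>2 - 1) * card variety)"
    unfolding isotropic_count_def 1[symmetric] by (simp only: card_insert_disjoint[OF finite]) simp
  have "{x. eval_form f x = 0 \<and> h x x = 0} = insert 0 {x. x \<noteq> 0 \<and> eval_form f x = 0 \<and> h x x = 0}"
    using f0 by auto
  then have 4: "card {x. eval_form f x = 0 \<and> h x x = 0} = Suc ((t\<^sup>2 - 1) * card (variety \<inter> zero_set f))"
    unfolding 2[symmetric] by (simp only: card_insert_disjoint[OF finite]) simp
  have "weight f = card variety - card (variety \<inter> zero_set f)"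
    by (rule hamming_weight_codeword[OF f]) (auto simp: in_variety_iff)
  moreover have "card (variety \<inter> zero_set f) \<le> card variety" by (intro card_mono) auto
  ultimately have w: "int (weight f) = int (card variety) - int (card (variety \<inter> zero_set f))"
    by (simp add: of_nat_diff)
  have q: "int (t\<^sup>2 - 1) = int t ^ 2 - 1" using t_gt_1 by (simp add: of_nat_diff)
  have "int t ^ 9 - int t ^ 5 + int t ^ 4 = 1 + (int t ^ 2 - 1) * int (card variety)"
    unfolding isotropic_count_UNIV[symmetric] 3 q[symmetric] by simp
  moreover have "int (card {x. eval_form f x = 0 \<and> h x x = 0}) = 1 + (int t ^ 2 - 1) * int (card (variety \<inter> zero_set f))"
    unfolding 4 q[symmetric] by simp
  ultimately show ?thesis unfolding w by (simp add: algebra_simps)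
qed

lemma weight_pair:
  assumes f: "f \<in> quadratic_forms" and i: "indep r s" and Z: "zero_set f = polar r \<union> polar s"
  shows "h r r = 0 \<Longrightarrow> h s s = 0 \<Longrightarrow> h r s \<noteq> 0 \<Longrightarrow>
      int (weight f) = int t ^ 7 - int t ^ 5 + int t ^ 3 - int t ^ 2"
    and "h s s = 0 \<Longrightarrow> h r s = 0 \<Longrightarrow> int (weight f) = int t ^ 7 - int t ^ 5"
    and "h r r \<noteq> 0 \<Longrightarrow> h s s = 0 \<Longrightarrow> h r s \<noteq> 0 \<Longrightarrow> int (weight f) = int t ^ 7 - int t ^ 5 - int t ^ 2"
    and "h r r \<noteq> 0 \<Longrightarrow> h s s \<noteq> 0 \<Longrightarrow> h r r * h s s = h r s * h s r \<Longrightarrow>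
      int (weight f) = int t ^ 7 - int t ^ 5 - int t ^ 3"
    and "h r r \<noteq> 0 \<Longrightarrow> h s s \<noteq> 0 \<Longrightarrow> h r r * h s s \<noteq> h r s * h s r \<Longrightarrow>
      int (weight f) = int t ^ 7 - int t ^ 5 - int t ^ 3 - int t ^ 2"
proof -
  have "eval_form f x = 0 \<longleftrightarrow> h x r = 0 \<or> h x s = 0" for x
  proof (cases "x = 0")
    case True
    then show ?thesis using eval_form_scale[OF f, of 0 0] by simp
  next
    case False
    then obtain Q where Q: "Q \<in> proj_space" "x \<in> Q" using proj_space_cover by blast
    then show ?thesis using in_zero_set_iff[OF f Q] Z in_polar_iff[OF Q] by simp
  qed
  then have "{x. eval_form f x = 0 \<and> h x x = 0} = {x \<in> {x. h x r = 0 \<or> h x s = 0}. h x x = 0}" by auto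
  then have W: "(int t ^ 2 - 1) * int (weight f) =
      int t ^ 9 - int t ^ 5 + int t ^ 4 - int (isotropic_count {x. h x r = 0 \<or> h x s = 0})"
    unfolding isotropic_count_def using weight_eq[OF f] by simp
  have "1 < int t ^ 2" using t_gt_1 by simp
  then have nz: "int t ^ 2 - 1 \<noteq> 0" by simp
  have cancel: "int (weight f) = w"
    if "int (isotropic_count {x. h x r = 0 \<or> h x s = 0}) = z"
      "int t ^ 9 - int t ^ 5 + int t ^ 4 - z = (int t ^ 2 - 1) * w" for z w
    using W that nz by simp
  have id1: "int t ^ 9 - int t ^ 5 + int t ^ 4 - (2 * int t ^ 7 - 3 * int t ^ 5 + 2 * int t ^ 4 + int t ^ 3 - int t ^ 2) = (int t ^ 2 - 1) * (int t ^ 7 - int t ^ 5 + int t ^ 3 - int t ^ 2)"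
    by algebra
  have id2: "int t ^ 9 - int t ^ 5 + int t ^ 4 - (2 * int t ^ 7 - 2 * int t ^ 5 + int t ^ 4) = (int t ^ 2 - 1) * (int t ^ 7 - int t ^ 5)"
    by algebra
  have id4: "int t ^ 9 - int t ^ 5 + int t ^ 4 - (2 * int t ^ 7 - 2 * int t ^ 5 + 2 * int t ^ 4 - int t ^ 2) = (int t ^ 2 - 1) * (int t ^ 7 - int t ^ 5 - int t ^ 2)"
    by algebra
  have id5: "int t ^ 9 - int t ^ 5 + int t ^ 4 - (2 * int t ^ 7 - int t ^ 5 + int t ^ 4 - int t ^ 3) = (int t ^ 2 - 1) * (int t ^ 7 - int t ^ 5 - int t ^ 3)"
    by algebra
  have id6: "int t ^ 9 - int t ^ 5 + int t ^ 4 - (2 * int t ^ 7 - int t ^ 5 + 2 * int t ^ 4 - int t ^ 3 - int t ^ 2) = (int t ^ 2 - 1) * (int t ^ 7 - int t ^ 5 - int t ^ 3 - int t ^ 2)"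
    by algebra
  show "h r r = 0 \<Longrightarrow> h s s = 0 \<Longrightarrow> h r s \<noteq> 0 \<Longrightarrow>
      int (weight f) = int t ^ 7 - int t ^ 5 + int t ^ 3 - int t ^ 2"
    by (rule cancel[OF isotropic_count_pair(1)[OF i] id1])
  show "h s s = 0 \<Longrightarrow> h r s = 0 \<Longrightarrow> int (weight f) = int t ^ 7 - int t ^ 5"
    by (cases "h r r = 0") (rule cancel[OF isotropic_count_pair(2)[OF i] id2],
        assumption+, rule cancel[OF isotropic_count_pair(3)[OF i] id2])
  show "h r r \<noteq> 0 \<Longrightarrow> h s s = 0 \<Longrightarrow> h r s \<noteq> 0 \<Longrightarrow> int (weight f) = int t ^ 7 - int t ^ 5 - int t ^ 2"
    by (rule cancel[OF isotropic_count_pair(4)[OF i] id4])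
  show "h r r \<noteq> 0 \<Longrightarrow> h s s \<noteq> 0 \<Longrightarrow> h r r * h s s = h r s * h s r \<Longrightarrow>
      int (weight f) = int t ^ 7 - int t ^ 5 - int t ^ 3"
    by (rule cancel[OF isotropic_count_pair(5)[OF i] id5])
  show "h r r \<noteq> 0 \<Longrightarrow> h s s \<noteq> 0 \<Longrightarrow> h r r * h s s \<noteq> h r s * h s r \<Longrightarrow>
      int (weight f) = int t ^ 7 - int t ^ 5 - int t ^ 3 - int t ^ 2"
    by (rule cancel[OF isotropic_count_pair(6)[OF i] id6])
qed

section \<open>The five smallest weights\<close>

definition low_weights :: "nat list" where
  "low_weights = [t ^ 7 - t ^ 5 - t ^ 3 - t ^ 2, t ^ 7 - t ^ 5 - t ^ 3, t ^ 7 - t ^ 5 - t ^ 2, t ^ 7 - t ^ 5,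
    t ^ 7 - t ^ 5 + t ^ 3 - t ^ 2]"

lemma t_powers: "t ^ 2 < t ^ 3" "2 * t ^ 3 \<le> t ^ 5" "2 * t ^ 5 \<le> t ^ 7" "0 < t ^ 2"
proof -
  have "1 * t ^ 2 < t * t ^ 2" using t_gt_1 by (intro mult_strict_right_mono) auto
  then show "t ^ 2 < t ^ 3" by (simp add: eval_nat_numeral)
  have t2: "2 \<le> t * t" using t_gt_1 mult_mono[of 2 t 1 t] by simp
  have "2 * t ^ 3 \<le> (t * t) * t ^ 3" using t2 by (rule mult_right_mono) simp
  then show "2 * t ^ 3 \<le> t ^ 5" by (simp add: eval_nat_numeral mult.assoc)
  have "2 * t ^ 5 \<le> (t * t) * t ^ 5" using t2 by (rule mult_right_mono) simp
  then show "2 * t ^ 5 \<le> t ^ 7" by (simp add: eval_nat_numeral mult.assoc)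
qed simp

lemma int_low_weights:
  "int (t ^ 7 - t ^ 5 - t ^ 3 - t ^ 2) = int t ^ 7 - int t ^ 5 - int t ^ 3 - int t ^ 2"
  "int (t ^ 7 - t ^ 5 - t ^ 3) = int t ^ 7 - int t ^ 5 - int t ^ 3"
  "int (t ^ 7 - t ^ 5 - t ^ 2) = int t ^ 7 - int t ^ 5 - int t ^ 2"
  "int (t ^ 7 - t ^ 5) = int t ^ 7 - int t ^ 5"
  "int (t ^ 7 - t ^ 5 + t ^ 3 - t ^ 2) = int t ^ 7 - int t ^ 5 + int t ^ 3 - int t ^ 2"
  using t_powers by (simp_all add: of_nat_diff flip: of_nat_power)

lemma low_weights_increasing:
  "0 < t ^ 7 - t ^ 5 - t ^ 3 - t ^ 2"
  "t ^ 7 - t ^ 5 - t ^ 3 - t ^ 2 < t ^ 7 - t ^ 5 - t ^ 3"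
  "t ^ 7 - t ^ 5 - t ^ 3 < t ^ 7 - t ^ 5 - t ^ 2"
  "t ^ 7 - t ^ 5 - t ^ 2 < t ^ 7 - t ^ 5"
  "t ^ 7 - t ^ 5 < t ^ 7 - t ^ 5 + t ^ 3 - t ^ 2"
  using t_powers by linarith+

text \<open>Multiplied by q - 1, the weight bound says that \<open>f\<close> has at least as many
  isotropic zeros as the smallest pair count. The strict estimate is then impossible, and the
  product of linear forms remains.\<close>

lemma low_weight_imp_pair:
  assumes t4: "t \<ge> 4" and f: "f \<in> quadratic_forms" and nz: "eval_form f w \<noteq> 0"
    and le: "weight f \<le> t ^ 7 - t ^ 5 + t ^ 3 - t ^ 2"
  shows "\<exists>r s. indep r s \<and> zero_set f = polar r \<union> polar s"
proof -
  obtain B where "quadratic_map (eval_form f) B" using quadratic_map_eval_form[OF f] by blast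
  then interpret hermitian_quadric t field_type "eval_form f" B
    using t4 by (intro hermitian_quadric.intro hermitian_field_axioms) (simp_all add: hermitian_quadric_axioms_def)
  have "int (weight f) \<le> int t ^ 7 - int t ^ 5 + int t ^ 3 - int t ^ 2"
    using le unfolding int_low_weights(5)[symmetric] of_nat_le_iff .
  moreover have "0 \<le> int t ^ 2 - 1" using t_gt_1 by simp
  ultimately have "(int t ^ 2 - 1) * int (weight f) \<le>
      (int t ^ 2 - 1) * (int t ^ 7 - int t ^ 5 + int t ^ 3 - int t ^ 2)"
    by (rule mult_left_mono)
  also have "\<dots> = int t ^ 9 - int t ^ 5 + int t ^ 4 -
      (2 * int t ^ 7 - 3 * int t ^ 5 + 2 * int t ^ 4 + int t ^ 3 - int t ^ 2)"
    by algebra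
  finally have "2 * int t ^ 7 - 3 * int t ^ 5 + 2 * int t ^ 4 + int t ^ 3 - int t ^ 2 \<le> int isotropic_zeros"
    unfolding weight_eq[OF f] by linarith
  then obtain u p where up: "eval_form f u = 0" "eval_form f p = 0" "B u p = 1"
    and prod: "\<And>x. eval_form f x = B u x * B p x"
    using isotropic_zeros_less_or_product[OF nz] by fastforce
  \<comment> \<open>The functional \<open>B y\<close> is a dot product with its values on the axes;
    conjugating that coefficient vector gives the pole.\<close>
  have rep: "\<exists>r. \<forall>x. B y x = h x r" for y
  proof -
    define a where "a = (\<chi> i. B y (axis i 1))"
    have "B y x = (\<Sum>i\<in>UNIV. a $ i * x $ i)" for x
    proof -
      have x: "x = (\<Sum>i\<in>UNIV. x $ i *s axis i 1)"
        by (simp add: vec_eq_iff axis_def if_distrib cong: if_cong)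
      have sum: "B y (\<Sum>i\<in>I. x $ i *s axis i 1) = (\<Sum>i\<in>I. x $ i * B y (axis i 1))" for I
        by (induction I rule: infinite_finite_induct) (simp_all add: B_simps)
      have "B y x = (\<Sum>i\<in>UNIV. x $ i * B y (axis i 1))"
        using arg_cong[OF x, of "B y"] unfolding sum .
      then show ?thesis by (simp add: a_def mult.commute)
    qed
    then have "B y x = h x (conj_vec a)" for x
      using sum_conj[of "conj_vec a" x] by simp
    then show ?thesis by blast
  qed
  obtain r where r: "\<And>x. B u x = h x r" using rep by blast
  obtain s where s: "\<And>x. B p x = h x s" using rep by blast
  have "B u u = 0" "B p p = 0" using up by (simp_all add: B_self)
  \<comment> \<open>The hyperbolic pair \<open>u\<close>, \<open>p\<close> separates the two
    functionals, so the poles are independent and the hyperplanes distinct.\<close>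
  then have v: "h u r = 0" "h p r = 1" "h u s = 1" "h p s = 0"
    using r[of u] r[of p] s[of p] s[of u] up(3) B_sym[of p u] by simp_all
  have "s \<noteq> c *s r" for c
  proof
    assume "s = c *s r"
    then have "h u s = c ^ t * h u r" by (simp add: h_scale_right)
    then show False using v by simp
  qed
  moreover have "r \<noteq> 0" using v by auto
  ultimately have "indep r s" by (simp add: indep_def)
  moreover have "Q \<in> zero_set f \<longleftrightarrow> Q \<in> polar r \<union> polar s" for Q
  proof (cases "Q \<in> proj_space")
    case True
    then obtain x where x: "x \<in> Q" using some_in_proj by blast
    show ?thesis
      using in_zero_set_iff[OF f True x] in_polar_iff[OF True x] by (simp add: prod r s)
  qed (auto simp: zero_set_def polar_def)
  ultimately show ?thesis by blast
qed

lemma weight_pair_cases: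
  assumes f: "f \<in> quadratic_forms" and i: "indep r s" and Z: "zero_set f = polar r \<union> polar s"
  shows "weight f \<in> set low_weights"
    and "weight f = t ^ 7 - t ^ 5 + t ^ 3 - t ^ 2 \<longleftrightarrow> h r r = 0 \<and> h s s = 0 \<and> h r s \<noteq> 0"
proof -
  have Z': "zero_set f = polar s \<union> polar r" using Z by (simp add: Un_commute)
  note pair = weight_pair[OF f i Z] and pair' = weight_pair[OF f indep_sym[OF i] Z']
  \<comment> \<open>The third and the fifth alternative are the second and the fourth with the poles
    exchanged, which \<open>pair'\<close> covers.\<close>
  consider "h r r = 0" "h s s = 0" "h r s \<noteq> 0" | "h s s = 0" "h r s = 0" | "h r r = 0" "h s r = 0"
    | "h r r \<noteq> 0" "h s s = 0" "h r s \<noteq> 0" | "h s s \<noteq> 0" "h r r = 0" "h s r \<noteq> 0"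
    | "h r r \<noteq> 0" "h s s \<noteq> 0" "h r r * h s s = h r s * h s r"
    | "h r r \<noteq> 0" "h s s \<noteq> 0" "h r r * h s s \<noteq> h r s * h s r"
    using h_eq_0_sym[of r s] by blast
  then have "(weight f = t ^ 7 - t ^ 5 + t ^ 3 - t ^ 2 \<and> h r r = 0 \<and> h s s = 0 \<and> h r s \<noteq> 0) \<or>
    (weight f \<in> {t ^ 7 - t ^ 5 - t ^ 3 - t ^ 2, t ^ 7 - t ^ 5 - t ^ 3, t ^ 7 - t ^ 5 - t ^ 2, t ^ 7 - t ^ 5}
      \<and> \<not> (h r r = 0 \<and> h s s = 0 \<and> h r s \<noteq> 0))"
  proof cases
    case 1
    have "int (weight f) = int (t ^ 7 - t ^ 5 + t ^ 3 - t ^ 2)"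
      unfolding int_low_weights using pair(1)[OF 1] .
    then show ?thesis using 1 unfolding of_nat_eq_iff by blast
  next
    case 2
    have "int (weight f) = int (t ^ 7 - t ^ 5)"
      unfolding int_low_weights using pair(2)[OF 2] .
    then show ?thesis using 2 unfolding of_nat_eq_iff by blast
  next
    case 3
    have "int (weight f) = int (t ^ 7 - t ^ 5)"
      unfolding int_low_weights using pair'(2)[OF 3] .
    then show ?thesis using 3 h_eq_0_sym[of r s] unfolding of_nat_eq_iff by blast
  next
    case 4
    have "int (weight f) = int (t ^ 7 - t ^ 5 - t ^ 2)"
      unfolding int_low_weights using pair(3)[OF 4] .
    then show ?thesis using 4 unfolding of_nat_eq_iff by blast
  next
    case 5
    have "int (weight f) = int (t ^ 7 - t ^ 5 - t ^ 2)"
      unfolding int_low_weights using pair'(3)[OF 5] .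
    then show ?thesis using 5 unfolding of_nat_eq_iff by blast
  next
    case 6
    have "int (weight f) = int (t ^ 7 - t ^ 5 - t ^ 3)"
      unfolding int_low_weights using pair(4)[OF 6] .
    then show ?thesis using 6 unfolding of_nat_eq_iff by blast
  next
    case 7
    have "int (weight f) = int (t ^ 7 - t ^ 5 - t ^ 3 - t ^ 2)"
      unfolding int_low_weights using pair(5)[OF 7] .
    then show ?thesis using 7 unfolding of_nat_eq_iff by blast
  qed
  note cases = this
  show "weight f \<in> set low_weights"
    using cases by (simp only: low_weights_def list.set) blast
  have "n \<noteq> t ^ 7 - t ^ 5 + t ^ 3 - t ^ 2"
    if "n \<in> {t ^ 7 - t ^ 5 - t ^ 3 - t ^ 2, t ^ 7 - t ^ 5 - t ^ 3, t ^ 7 - t ^ 5 - t ^ 2, t ^ 7 - t ^ 5}" for n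
    using that low_weights_increasing by (elim insertE emptyE) linarith+
  then show "weight f = t ^ 7 - t ^ 5 + t ^ 3 - t ^ 2 \<longleftrightarrow> h r r = 0 \<and> h s s = 0 \<and> h r s \<noteq> 0"
    using cases by blast
qed

lemma ex_form_pair:
  fixes r s :: "'a ^ 5"
  shows "\<exists>f\<in>quadratic_forms. zero_set f = polar r \<union> polar s"
proof -
  obtain f :: "(5, 'a) mpol" where f: "f \<in> quadratic_forms"
    "\<And>x. eval_form f x = (\<Sum>i\<in>UNIV. conj_vec r $ i * x $ i) * (\<Sum>i\<in>UNIV. conj_vec s $ i * x $ i)"
    using ex_form_product[of "conj_vec r" "conj_vec s"] by blast
  have "Q \<in> zero_set f \<longleftrightarrow> Q \<in> polar r \<union> polar s" for Q
  proof (cases "Q \<in> proj_space")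
    case True
    then obtain x where x: "x \<in> Q" using some_in_proj by blast
    show ?thesis
      using in_zero_set_iff[OF f(1) True x] in_polar_iff[OF True x] by (simp add: f(2) sum_conj)
  qed (auto simp: zero_set_def polar_def)
  then show ?thesis using f(1) by blast
qed

lemma indepI: "r \<noteq> 0 \<Longrightarrow> r $ k = 0 \<Longrightarrow> s $ k \<noteq> 0 \<Longrightarrow> indep r s"
  unfolding indep_def by auto

text \<open>Since -1 has several preimages under the norm, isotropic vectors of the shape
  \<open>e 1 + c *s e 2\<close> exist, and two of them for distinct \<open>c\<close> are not
  orthogonal. With the axes they realise every relation between two poles.\<close>

lemma low_weights_attained:
  assumes "v \<in> set low_weights"
  shows "\<exists>f\<in>quadratic_forms. weight f = v"
proof -
  have "(- 1 :: 'a) ^ t = - 1" using frob_minus[of 1] by simp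
  then have "card {x::'a. x ^ (t + 1) = - 1} = t + 1" by (intro card_norm) (simp_all add: subfield_def)
  then have c2: "1 < card {x::'a. x ^ (t + 1) = - 1}" using t_gt_1 by simp
  then obtain a b :: 'a where ab: "a ^ (t + 1) = - 1" "b ^ (t + 1) = - 1" "a \<noteq> b"
    by (auto simp: card_le_Suc0_iff_eq not_le[symmetric])
  have a0: "a \<noteq> 0" using ab(1) by auto
  define e :: "5 \<Rightarrow> 'a ^ 5" where "e = (\<lambda>i. axis i 1)"
  define g where "g = (\<lambda>c. e 1 + c *s e 2)"
  have hee: "h (e i) (e j) = (if i = j then 1 else 0)" for i j
    unfolding e_def h_axis_right by (simp add: axis_def)
  have ecomp: "e i $ j = (if j = i then 1 else 0)" for i j by (simp add: e_def axis_def)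
  have g: "h (g c) (g d) = 1 + c * d ^ t" "h (g c) (e 1) = 1" "h (e 1) (g c) = 1"
    "h (g c) (e 0) = 0" "h (e 0) (g c) = 0" for c d
    by (simp_all add: g_def h_simps hee)
  have ga: "h (g a) (g a) = 0" "h (g b) (g b) = 0"
    using ab by (simp_all add: g)
  have gab: "h (g a) (g b) \<noteq> 0"
  proof
    assume "h (g a) (g b) = 0"
    then have "1 + a * b ^ t = 1 + b * b ^ t" using ga(2) by (simp only: g)
    then have "a * b ^ t = b * b ^ t" by simp
    moreover have "b ^ t \<noteq> 0" using ab(2) by auto
    ultimately show False using ab(3) by simp
  qed
  have e0: "e i \<noteq> 0" for i using ecomp[of i i] by auto
  have ex: "\<exists>f\<in>quadratic_forms. int (weight f) = w"
    if "indep r s" "\<And>f. f \<in> quadratic_forms \<Longrightarrow> zero_set f = polar r \<union> polar s \<Longrightarrow> int (weight f) = w" for r s w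
    using that ex_form_pair[of r s] by blast
  \<comment> \<open>One pair for each weight: \<open>i1\<close> orthonormal, \<open>i2\<close>
    nonisotropic with Gram determinant 1 - 1 = 0, \<open>i3\<close> nonisotropic and isotropic but
    not orthogonal, \<open>i4\<close> the same but orthogonal, \<open>i5\<close> isotropic and not
    orthogonal.\<close>
  have i1: "indep (e 0) (e 1)" by (rule indepI[of _ 1]) (simp_all add: e0 ecomp)
  have i2: "indep (e 0) (e 0 + g a)" by (rule indepI[of _ 1]) (simp_all add: e0 ecomp g_def)
  have i3: "indep (e 1) (g a)" by (rule indepI[of _ 2]) (simp_all add: e0 ecomp g_def a0)
  have i4: "indep (e 0) (g a)" by (rule indepI[of _ 1]) (simp_all add: e0 ecomp g_def)
  have "g b \<noteq> c *s g a" for c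
  proof
    assume "g b = c *s g a"
    then have "h (g a) (g b) = c ^ t * h (g a) (g a)" by (simp only: h_scale_right)
    then show False using gab ga by simp
  qed
  then have i5: "indep (g a) (g b)" using gab by (auto simp: indep_def)
  have "\<exists>f\<in>quadratic_forms. int (weight f) = int (t ^ 7 - t ^ 5 - t ^ 3 - t ^ 2)"
    unfolding int_low_weights by (rule ex[OF i1], rule weight_pair(5)[OF _ i1]) (simp_all add: hee)
  moreover have "\<exists>f\<in>quadratic_forms. int (weight f) = int (t ^ 7 - t ^ 5 - t ^ 3)"
    unfolding int_low_weights by (rule ex[OF i2], rule weight_pair(4)[OF _ i2]) (simp_all add: hee g(4,5) ga h_add_left h_add_right)
  moreover have "\<exists>f\<in>quadratic_forms. int (weight f) = int (t ^ 7 - t ^ 5 - t ^ 2)"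
    unfolding int_low_weights by (rule ex[OF i3], rule weight_pair(3)[OF _ i3]) (simp_all add: hee g(2,3) ga)
  moreover have "\<exists>f\<in>quadratic_forms. int (weight f) = int (t ^ 7 - t ^ 5)"
    unfolding int_low_weights by (rule ex[OF i4], rule weight_pair(2)[OF _ i4]) (simp_all add: hee g(4,5) ga)
  moreover have "\<exists>f\<in>quadratic_forms. int (weight f) = int (t ^ 7 - t ^ 5 + t ^ 3 - t ^ 2)"
    unfolding int_low_weights by (rule ex[OF i5], rule weight_pair(1)[OF _ i5]) (simp_all add: ga gab)
  ultimately show ?thesis using assms by (auto simp only: of_nat_eq_iff low_weights_def set_simps)
qed

lemma weight_eq_0_iff:
  assumes f: "f \<in> quadratic_forms"
  shows "weight f = 0 \<longleftrightarrow> codeword variety f = (\<lambda>_. 0)"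
  by (auto simp: hamming_weight_def codeword_def fun_eq_iff)

lemma codeword_zero_if_vanishing:
  assumes "\<And>x. eval_form f x = 0"
  shows "codeword variety f = (\<lambda>_. 0)"
  by (simp add: codeword_def code_coord_def assms fun_eq_iff Let_def)

lemma nonzero_weights_le_fifth:
  assumes t4: "t \<ge> 4"
  shows "{v \<in> nonzero_weights variety (functional_code2 variety). v \<le> t ^ 7 - t ^ 5 + t ^ 3 - t ^ 2} = set low_weights"
proof (intro equalityI subsetI)
  fix v assume v: "v \<in> {v \<in> nonzero_weights variety (functional_code2 variety). v \<le> t ^ 7 - t ^ 5 + t ^ 3 - t ^ 2}"
  then obtain f where f: "f \<in> quadratic_forms" "codeword variety f \<noteq> (\<lambda>_. 0)" "v = weight f"
    by (auto simp: nonzero_weights_def functional_code2_def)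
  then obtain w where w: "eval_form f w \<noteq> 0" using codeword_zero_if_vanishing by blast
  have "weight f \<le> t ^ 7 - t ^ 5 + t ^ 3 - t ^ 2" using v f(3) by simp
  then obtain r s where "indep r s" "zero_set f = polar r \<union> polar s"
    using low_weight_imp_pair[OF t4 f(1) w] by blast
  then show "v \<in> set low_weights" using weight_pair_cases(1)[OF f(1)] f(3) by blast
next
  fix v assume v: "v \<in> set low_weights"
  then obtain f where f: "f \<in> quadratic_forms" "weight f = v" using low_weights_attained by blast
  have "0 < v" "v \<le> t ^ 7 - t ^ 5 + t ^ 3 - t ^ 2"
    using v low_weights_increasing by (auto simp: low_weights_def)
  moreover have "codeword variety f \<noteq> (\<lambda>_. 0)" using \<open>0 < v\<close> weight_eq_0_iff[OF f(1)] f(2) by simp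
  ultimately show "v \<in> {v \<in> nonzero_weights variety (functional_code2 variety). v \<le> t ^ 7 - t ^ 5 + t ^ 3 - t ^ 2}"
    using f by (auto simp: nonzero_weights_def functional_code2_def)
qed

theorem fifth_weight:
  assumes t4: "t \<ge> 4"
  shows "is_ith_weight 5 variety (functional_code2 variety) (t ^ 7 - t ^ 5 + t ^ 3 - t ^ 2)"
proof -
  note eq = nonzero_weights_le_fifth[OF t4]
  have "distinct low_weights" using low_weights_increasing by (simp add: low_weights_def)
  then have "card (set low_weights) = 5" by (simp only: distinct_card) (simp add: low_weights_def)
  moreover have "t ^ 7 - t ^ 5 + t ^ 3 - t ^ 2 \<in> set low_weights" by (simp add: low_weights_def)
  ultimately show ?thesis unfolding is_ith_weight_def eq using eq by blast
qed

text \<open>In terms of the poles, the hyperplane condition reads \<open>h r r = 0\<close>,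
  \<open>h s s = 0\<close>, \<open>h r s \<noteq> 0\<close>, the only configuration of a pair with
  this weight.\<close>

theorem fifth_weight_iff:
  assumes t4: "t \<ge> 4" and f: "f \<in> quadratic_forms"
  shows "weight f = t ^ 7 - t ^ 5 + t ^ 3 - t ^ 2 \<longleftrightarrow>
    (\<exists>H1 H2. is_hyperplane H1 \<and> is_hyperplane H2 \<and> H1 \<noteq> H2 \<and>
            zero_set f = H1 \<union> H2 \<and>
            tangent_to_hermitian t H1 \<and> tangent_to_hermitian t H2 \<and>
            nonsingular_plane_section t (H1 \<inter> H2))" (is "?l \<longleftrightarrow> ?r")
proof
  assume l: ?l
  then have "weight f \<noteq> 0" using low_weights_increasing by simp
  then have "codeword variety f \<noteq> (\<lambda>_. 0)" using weight_eq_0_iff[OF f] by simp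
  then obtain w where w: "eval_form f w \<noteq> 0" using codeword_zero_if_vanishing by blast
  obtain r s where rs: "indep r s" "zero_set f = polar r \<union> polar s"
    using low_weight_imp_pair[OF t4 f w eq_refl[OF l]] by blast
  then have iso: "h r r = 0" "h s s = 0" "h r s \<noteq> 0" using weight_pair_cases(2)[OF f rs] l by auto
  have "r \<noteq> 0" "s \<noteq> 0" using rs(1) indep_sym[OF rs(1)] by (simp_all add: indep_def)
  then show ?r
    using rs(2) iso nonsingular_plane_section_iff[OF rs(1)]
    by (intro exI[of _ "polar r"] exI[of _ "polar s"])
      (simp add: is_hyperplane_polar tangent_polar_iff polar_neq[OF rs(1)])
next
  assume ?r
  then obtain H1 H2 where H: "H1 \<noteq> H2" "zero_set f = H1 \<union> H2" "tangent_to_hermitian t H1"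
    "tangent_to_hermitian t H2" "nonsingular_plane_section t (H1 \<inter> H2)" by blast
  obtain r where r: "r \<noteq> 0" "h r r = 0" "H1 = polar r" using tangent_imp_polar[OF H(3)] by blast
  obtain s where s: "s \<noteq> 0" "h s s = 0" "H2 = polar s" using tangent_imp_polar[OF H(4)] by blast
  have i: "indep r s" using indep_if_polar_neq H(1) r s by blast
  then have "h r s \<noteq> 0" using nonsingular_plane_section_iff[OF i r(2) s(2)] H(5) r s by blast
  then show ?l using weight_pair_cases(2)[OF f i] H(2) r s by blast
qed

end

theorem theorem6p8:
  fixes t :: nat and X :: "('a::{field,finite} ^ 5) set set"
  assumes "primepow t" and "t \<noteq> 2" and "t \<noteq> 3"
    and "CARD('a) = t\<^sup>2"
    and "X = hermitian_variety t"
  shows "is_ith_weight 5 X (functional_code2 X) (t^7 - t^5 + t^3 - t^2)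
    \<and> (\<forall>f\<in>quadratic_forms.
         hamming_weight X (codeword X f) = t^7 - t^5 + t^3 - t^2 \<longleftrightarrow>
         (\<exists>H1 H2. is_hyperplane H1 \<and> is_hyperplane H2 \<and> H1 \<noteq> H2 \<and>
            zero_set f = H1 \<union> H2 \<and>
            tangent_to_hermitian t H1 \<and> tangent_to_hermitian t H2 \<and>
            nonsingular_plane_section t (H1 \<inter> H2)))"
proof -
  interpret hermitian_field t "TYPE('a)"
    using assms by unfold_locales
  have "t \<ge> 4" using t_gt_1 assms(2,3) by linarith
  then show ?thesis
    unfolding assms(5) by (intro conjI ballI fifth_weight fifth_weight_iff)
qed

end
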